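(* Let $a,b>0$ with $ab>1$. If $a=b$, then $Q(a,b;t)=0$ for every $t>b$. If $a<b$, then there exists $t>b$ such that $Q(a,b;t)=0$.
   Context: For real $a,b,t>0$ with $1/t<1/a<b<t$ let $v_1<\dots<v_8$ be $-t,-a,-1/b,-1/t,1/t,1/a,b,t$, let $f_1(x)=|x+a|^{1/2}|x+1/b|^{-1/2}|x-1/a|^{1/2}|x-b|^{-1/2}|(x^2-t^2)(x^2-t^{-2})|^{-1/2}$ and $f_2(x)=|x+a|^{-1/2}|x+1/b|^{1/2}|x-1/a|^{-1/2}|x-b|^{1/2}|(x^2-t^2)(x^2-t^{-2})|^{-1/2}$, $I_k=\int_{v_k}^{v_{k+1}}f_1\,dx$, $J_k=\int_{v_k}^{v_{k+1}}f_2\,dx$, and $Q(a,b;t)=\frac{I_1+I_3}{I_2}-\frac{J_1+J_3}{J_2}$. (These are the edge lengths, for Lopez–Ros factor $\rho=1$, of the images of the upper half-plane under $\int\phi_1,\int\phi_2$ for the Weierstrass data of the surfaces in the class $\mathcal O$; $Q=0$ is the period condition.) *)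

theory Defs
  imports "HOL-Analysis.Analysis"
begin

text \<open>Weierstrass-data integrands (Lopez--Ros factor 1).\<close>

definition f1 :: "real \<Rightarrow> real \<Rightarrow> real \<Rightarrow> real \<Rightarrow> real" where
  "f1 a b t x =
     \<bar>x + a\<bar> powr (1/2) * \<bar>x + 1/b\<bar> powr (-1/2) * \<bar>x - 1/a\<bar> powr (1/2)
     * \<bar>x - b\<bar> powr (-1/2) * \<bar>(x^2 - t^2) * (x^2 - t powr (-2))\<bar> powr (-1/2)"

definition f2 :: "real \<Rightarrow> real \<Rightarrow> real \<Rightarrow> real \<Rightarrow> real" where
  "f2 a b t x =
     \<bar>x + a\<bar> powr (-1/2) * \<bar>x + 1/b\<bar> powr (1/2) * \<bar>x - 1/a\<bar> powr (-1/2)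
     * \<bar>x - b\<bar> powr (1/2) * \<bar>(x^2 - t^2) * (x^2 - t powr (-2))\<bar> powr (-1/2)"

definition vtx :: "real \<Rightarrow> real \<Rightarrow> real \<Rightarrow> nat \<Rightarrow> real" where
  "vtx a b t k =
     (if k = 1 then -t else if k = 2 then -a else if k = 3 then -1/b else if k = 4 then -1/t
      else if k = 5 then 1/t else if k = 6 then 1/a else if k = 7 then b else t)"

definition Iint :: "real \<Rightarrow> real \<Rightarrow> real \<Rightarrow> nat \<Rightarrow> real" where
  "Iint a b t k = integral {vtx a b t k .. vtx a b t (k+1)} (f1 a b t)"

definition Jint :: "real \<Rightarrow> real \<Rightarrow> real \<Rightarrow> nat \<Rightarrow> real" where
  "Jint a b t k = integral {vtx a b t k .. vtx a b t (k+1)} (f2 a b t)"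

definition Q :: "real \<Rightarrow> real \<Rightarrow> real \<Rightarrow> real" where
  "Q a b t = (Iint a b t 1 + Iint a b t 3) / Iint a b t 2
           - (Jint a b t 1 + Jint a b t 3) / Jint a b t 2"

end

theory Submission
  imports Defs
begin

text \<open>
  Put \<open>A = a - 1/a\<close>, \<open>B = b - 1/b\<close>, \<open>T = t - 1/t\<close>. The substitution \<open>u = x - 1/x\<close> carries the three edges
  to \<open>[-T, -A]\<close>, \<open>[-A, B]\<close>, \<open>[B, T]\<close> and the first integrand to
  \<open>sqrt (\<bar>u + A\<bar> / (\<bar>u - B\<bar> * \<bar>u\<^sup>2 - T\<^sup>2\<bar> * (u\<^sup>2 + 4)))\<close>; the second integrand arises from it by
  \<open>u \<mapsto> - u\<close> and exchanging \<open>A\<close> with \<open>B\<close>, which settles the case \<open>a = b\<close>.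
  Parametrising each edge as \<open>u = p + (q - p) sin\<^sup>2 \<theta>\<close> removes all endpoint singularities, so the
  integrals depend continuously on \<open>T\<close>. For \<open>A < B\<close> the sign of \<open>Q\<close> changes: as \<open>T\<close> decreases to \<open>B\<close>, \<open>I\<^sub>2\<close>
  diverges logarithmically while \<open>I\<^sub>1\<close>, \<open>I\<^sub>3\<close>, \<open>J\<^sub>2\<close> stay bounded and \<open>J\<^sub>1\<close> stays away from \<open>0\<close>, so
  \<open>Q < 0\<close>; as \<open>T\<close> tends to infinity, \<open>T (I\<^sub>1 + I\<^sub>3)\<close> diverges, \<open>T (J\<^sub>1 + J\<^sub>3 - I\<^sub>1 - I\<^sub>3)\<close> is bounded
  above, and \<open>T (J\<^sub>2 - I\<^sub>2)\<close> has a positive limit, so \<open>Q > 0\<close>.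
\<close>

section \<open>The substitution \<open>u = x - 1/x\<close>\<close>

text \<open>The negative root \<open>x\<close> of \<open>x - 1/x = u\<close>.\<close>

definition neg_branch :: "real \<Rightarrow> real" where
  "neg_branch u = (u - sqrt (u\<^sup>2 + 4)) / 2"

lemma sqrt_sq_plus_4_gt: "\<bar>u\<bar> < sqrt (u\<^sup>2 + 4)"
  by (rule real_less_rsqrt) simp

lemma neg_branch_neg: "neg_branch u < 0"
  using sqrt_sq_plus_4_gt[of u] by (simp add: neg_branch_def)

lemma neg_branch_quadratic: "(neg_branch u)\<^sup>2 = u * neg_branch u + 1"
proof -
  have "(sqrt (u\<^sup>2 + 4))\<^sup>2 = u\<^sup>2 + 4"
    by simp
  then show ?thesis
    unfolding neg_branch_def by (simp add: power2_eq_square field_simps)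
qed

lemma neg_branch_inverse: "neg_branch u - 1 / neg_branch u = u"
  using neg_branch_quadratic[of u] neg_branch_neg[of u]
  by (simp add: field_simps power2_eq_square)

text \<open>\<open>(x - 1/x)^2 + 4\<close> is the square of \<open>x + 1/x\<close>, and the negative
  sign of \<open>x + 1/x\<close> decides which root is taken.\<close>

lemma neg_branch_unique:
  assumes "x < 0"
  shows "neg_branch (x - 1 / x) = x"
proof -
  have "(x - 1 / x)\<^sup>2 + 4 = (x + 1 / x)\<^sup>2"
    using assms by (simp add: power2_eq_square field_simps)
  moreover have "x + 1 / x < 0"
    using assms by (simp add: add_neg_neg)
  ultimately have "sqrt ((x - 1 / x)\<^sup>2 + 4) = - (x + 1 / x)"
    by simp
  then show ?thesis
    by (simp add: neg_branch_def)
qed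

lemma neg_branch_has_derivative:
  "(neg_branch has_real_derivative (- neg_branch u / sqrt (u\<^sup>2 + 4))) (at u within S)"
proof -
  have p: "0 < u\<^sup>2 + 4"
    by (simp add: add_nonneg_pos)
  have eq: "neg_branch = (\<lambda>u. (u - sqrt (u\<^sup>2 + 4)) / 2)"
    by (simp add: fun_eq_iff neg_branch_def)
  have val: "- neg_branch u / sqrt (u\<^sup>2 + 4) = (1 - (inverse (sqrt (u\<^sup>2 + 4)) / 2) * (2 * u)) / 2"
    using p by (simp add: neg_branch_def field_simps)
  show ?thesis
    unfolding val unfolding eq using p by (auto intro!: derivative_eq_intros)
qed

lemma neg_branch_strict_mono: "u < v \<Longrightarrow> neg_branch u < neg_branch v"
proof (erule DERIV_pos_imp_increasing[of u v neg_branch])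
  fix w :: real
  have "0 < - neg_branch w / sqrt (w\<^sup>2 + 4)"
    using neg_branch_neg[of w] by (intro divide_pos_pos) (simp_all add: add_nonneg_pos)
  then show "\<exists>y. (neg_branch has_real_derivative y) (at w) \<and> 0 < y"
    using neg_branch_has_derivative by blast
qed

lemma neg_branch_mono: "u \<le> v \<Longrightarrow> neg_branch u \<le> neg_branch v"
  using neg_branch_strict_mono[of u v] by (cases "u = v") auto

section \<open>Trigonometric parametrisation of an interval\<close>

definition sin_arc :: "real \<Rightarrow> real \<Rightarrow> real \<Rightarrow> real" where
  "sin_arc p q \<theta> = p + (q - p) * (sin \<theta>)\<^sup>2"

lemma sin_arc_cos: "sin_arc p q \<theta> = q - (q - p) * (cos \<theta>)\<^sup>2"
  by (simp add: sin_arc_def sin_squared_eq algebra_simps)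

lemma sin_arc_0 [simp]: "sin_arc p q 0 = p" and sin_arc_half_pi [simp]: "sin_arc p q (pi / 2) = q"
  by (simp_all add: sin_arc_def)

lemma sin_arc_bounds:
  assumes "p \<le> q"
  shows "p \<le> sin_arc p q \<theta>" and "sin_arc p q \<theta> \<le> q"
  using assms by (simp add: sin_arc_def, simp add: sin_arc_cos)

lemma sin_arc_uminus: "sin_arc (- p) (- q) \<theta> = - sin_arc p q \<theta>"
  by (simp add: sin_arc_def algebra_simps)

lemma sin_arc_has_derivative:
  "(sin_arc p q has_real_derivative ((q - p) * (2 * sin \<theta> * cos \<theta>))) (at \<theta> within S)"
  unfolding sin_arc_def[abs_def] by (auto intro!: derivative_eq_intros)

lemma continuous_on_sin_arc [continuous_intros]:
  fixes f :: "'a::metric_space \<Rightarrow> real"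
  assumes "continuous_on S p" "continuous_on S q" "continuous_on S f"
  shows "continuous_on S (\<lambda>x. sin_arc (p x) (q x) (f x))"
  unfolding sin_arc_def using assms by (auto intro!: continuous_intros)

lemma sin_cos_pos:
  assumes "\<theta> \<in> {0<..<pi / 2}"
  shows "0 < sin \<theta>" and "0 < cos \<theta>"
  using assms by (auto intro: sin_gt_zero2 cos_gt_zero)

lemma sin_cos_nonneg:
  assumes "\<theta> \<in> {0..pi / 2}"
  shows "0 \<le> sin \<theta>" and "0 \<le> cos \<theta>"
  using assms by (auto intro: sin_ge_zero cos_ge_zero)

lemma inj_on_sin_arc:
  assumes "p \<noteq> q"
  shows "inj_on (sin_arc p q) {0..pi / 2}"
proof (rule inj_onI)
  fix x y assume xy: "x \<in> {0..pi / 2}" "y \<in> {0..pi / 2}" "sin_arc p q x = sin_arc p q y"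
  then have "sin x = sin y"
    using assms sin_cos_nonneg by (simp add: sin_arc_def)
  then show "x = y"
    using xy sin_inj_pi[of x y] by auto
qed

text \<open>Along \<open>x = neg_branch u\<close> one has
  \<open>dx/du = \<bar>x\<bar> / sqrt (u^2 + 4)\<close>, so the factor \<open>\<bar>x\<bar>\<close>
  in the hypothesis on \<open>f\<close> is the one supplied by the Jacobian, and only
  \<open>u\<close> remains. Agreement with \<open>h\<close> is asked on the open interval only: at
  the ends \<open>f\<close> may be singular while \<open>h\<close> extends continuously. Both orders
  of \<open>p\<close> and \<open>q\<close> are allowed, hence \<open>closed_segment\<close>.\<close>

lemma integral_substitution_sin_arc:
  assumes pq: "p \<noteq> q"
    and h: "continuous_on {0..pi / 2} h"
    and f: "\<And>x. x < 0 \<Longrightarrow> f x * \<bar>x\<bar> = F (x - 1 / x)"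
    and eq: "\<And>\<theta>. \<theta> \<in> {0<..<pi / 2} \<Longrightarrow>
      F (sin_arc p q \<theta>) / sqrt ((sin_arc p q \<theta>)\<^sup>2 + 4) * \<bar>q - p\<bar> * (2 * sin \<theta> * cos \<theta>) = h \<theta>"
  shows "integral (closed_segment (neg_branch p) (neg_branch q)) f = integral {0..pi / 2} h"
proof -
  define S where "S = {0..pi / 2 :: real}"
  define g where "g \<theta> = neg_branch (sin_arc p q \<theta>)" for \<theta>
  define g' where "g' \<theta> = - neg_branch (sin_arc p q \<theta>) / sqrt ((sin_arc p q \<theta>)\<^sup>2 + 4)
    * ((q - p) * (2 * sin \<theta> * cos \<theta>))" for \<theta>
  have g': "(g has_real_derivative g' \<theta>) (at \<theta> within S)" for \<theta>
    unfolding g_def[abs_def] g'_def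
    by (rule DERIV_chain'[OF sin_arc_has_derivative neg_branch_has_derivative])
  have inj: "inj_on g S"
  proof (rule inj_onI)
    fix x y assume xy: "x \<in> S" "y \<in> S" "g x = g y"
    have "sin_arc p q x = sin_arc p q y"
      using xy(3) neg_branch_inverse unfolding g_def by metis
    then show "x = y"
      using inj_onD[OF inj_on_sin_arc[OF pq]] xy by (simp add: S_def)
  qed
  have cont: "continuous_on S g"
    by (rule DERIV_continuous_on) (rule g')
  have img: "g ` S = closed_segment (neg_branch p) (neg_branch q)"
  proof
    show "g ` S \<subseteq> closed_segment (neg_branch p) (neg_branch q)"
    proof
      fix y assume "y \<in> g ` S"
      then obtain \<theta> where y: "y = neg_branch (sin_arc p q \<theta>)"
        by (auto simp: g_def)
      show "y \<in> closed_segment (neg_branch p) (neg_branch q)"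
      proof (cases "p \<le> q")
        case True
        then show ?thesis
          using sin_arc_bounds[of p q \<theta>] by (auto simp: y closed_segment_eq_real_ivl intro!: neg_branch_mono)
      next
        case False
        then have "- p \<le> - q" by simp
        from sin_arc_bounds[OF this, of \<theta>] have "q \<le> sin_arc p q \<theta>" "sin_arc p q \<theta> \<le> p"
          by (simp_all add: sin_arc_uminus)
        then show ?thesis
          using False neg_branch_strict_mono[of q p]
          by (auto simp: y closed_segment_eq_real_ivl intro!: neg_branch_mono)
      qed
    qed
    \<comment> \<open>Intermediate values: the image is an interval containing both end
      values.\<close>
    have "connected (g ` S)"
      by (rule connected_continuous_image[OF cont]) (simp add: S_def)
    then have "convex (g ` S)"
      by (simp only: connected_convex_1)
    moreover have "g 0 \<in> g ` S" "g (pi / 2) \<in> g ` S"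
      by (auto simp: S_def)
    then have "neg_branch p \<in> g ` S" "neg_branch q \<in> g ` S"
      by (simp_all add: g_def)
    ultimately show "closed_segment (neg_branch p) (neg_branch q) \<subseteq> g ` S"
      by (intro closed_segment_subset) simp_all
  qed
  have int_eq: "\<bar>g' \<theta>\<bar> * f (g \<theta>) = h \<theta>" if "\<theta> \<in> S - {0, pi / 2}" for \<theta>
  proof -
    have \<theta>: "\<theta> \<in> {0<..<pi / 2}"
      using that by (auto simp: S_def)
    have F: "f (g \<theta>) * \<bar>g \<theta>\<bar> = F (sin_arc p q \<theta>)"
      using f[OF neg_branch_neg] by (simp add: g_def neg_branch_inverse)
    have G: "\<bar>g' \<theta>\<bar> = \<bar>g \<theta>\<bar> / sqrt ((sin_arc p q \<theta>)\<^sup>2 + 4) * \<bar>q - p\<bar> * (2 * sin \<theta> * cos \<theta>)"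
      using sin_cos_pos[OF \<theta>] by (simp add: g'_def g_def abs_mult)
    show ?thesis
      unfolding G eq[OF \<theta>, symmetric] F[symmetric] by (simp add: mult_ac)
  qed
  \<comment> \<open>Integrability of the possibly unbounded \<open>f\<close> is obtained backwards:
    the pulled-back integrand equals the continuous \<open>h\<close> off two points, and the change
    of variables theorem carries this over to \<open>f\<close>.\<close>
  have ai: "h absolutely_integrable_on S"
    using h unfolding S_def by (rule absolutely_integrable_continuous_real)
  have "(\<lambda>\<theta>. \<bar>g' \<theta>\<bar> * f (g \<theta>)) absolutely_integrable_on S"
    by (rule absolutely_integrable_spike[OF ai, of "{0, pi / 2}"]) (use int_eq in auto)
  moreover have "integral S (\<lambda>\<theta>. \<bar>g' \<theta>\<bar> * f (g \<theta>)) = integral S h"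
    by (rule integral_spike[of "{0, pi / 2}"]) (use int_eq in auto)
  ultimately have "integral (g ` S) f = integral S h"
    using has_absolute_integral_change_of_variables_1'[OF _ g' inj] by (auto simp: S_def)
  then show ?thesis
    unfolding img by (simp only: S_def)
qed

section \<open>The Weierstrass integrands in the variable \<open>u\<close>\<close>

definition edge_fun :: "real \<Rightarrow> real \<Rightarrow> real \<Rightarrow> real \<Rightarrow> real" where
  "edge_fun A B T u = sqrt (\<bar>u + A\<bar> / (\<bar>u - B\<bar> * \<bar>u\<^sup>2 - T\<^sup>2\<bar>))"

lemma powr_half_eq_sqrt:
  fixes x :: real
  assumes "0 \<le> x"
  shows "x powr (1/2) = sqrt x" and "x powr (-1/2) = 1 / sqrt x"
proof -
  show *: "x powr (1/2) = sqrt x"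
    using assms by (simp add: powr_half_sqrt)
  have "x powr (-1/2) = inverse (x powr (1/2))"
    using powr_minus[of x "1/2"] by simp
  then show "x powr (-1/2) = 1 / sqrt x"
    unfolding * by (simp only: inverse_eq_divide)
qed

text \<open>The points \<open>-a\<close> and \<open>1/a\<close> are the two roots of
  \<open>x - 1/x = -A\<close>, so \<open>(x + a) (x - 1/a) = x (u + A)\<close>; likewise
  \<open>(x + 1/b) (x - b) = x (u - B)\<close>, and the quartic is \<open>x^2 (u^2 - T^2)\<close>.
  The powers of \<open>x\<close> combine to \<open>1 / \<bar>x\<bar>\<close>. The factor
  \<open>u^2 + 4\<close> comes only with the Jacobian and is therefore absent from
  \<open>edge_fun\<close>.\<close>

lemma f1_edge_fun:
  assumes x: "x \<noteq> 0" and a: "a > 0" and b: "b > 0" and t: "t > 0"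
  shows "f1 a b t x * \<bar>x\<bar> = edge_fun (a - 1/a) (b - 1/b) (t - 1/t) (x - 1/x)"
proof -
  let ?u = "x - 1/x"
  have 1: "\<bar>x + a\<bar> * \<bar>x - 1/a\<bar> = \<bar>x\<bar> * \<bar>?u + (a - 1/a)\<bar>"
    unfolding abs_mult[symmetric] using x a by (intro arg_cong[where f = abs]) (simp add: field_simps)
  have 2: "\<bar>x + 1/b\<bar> * \<bar>x - b\<bar> = \<bar>x\<bar> * \<bar>?u - (b - 1/b)\<bar>"
    unfolding abs_mult[symmetric] using x b by (intro arg_cong[where f = abs]) (simp add: field_simps)
  have "t powr (-2) = 1 / t\<^sup>2"
    using t by (simp add: powr_minus powr_numeral divide_inverse)
  then have 3: "\<bar>(x\<^sup>2 - t\<^sup>2) * (x\<^sup>2 - t powr (-2))\<bar> = \<bar>x\<bar>\<^sup>2 * \<bar>?u\<^sup>2 - (t - 1/t)\<^sup>2\<bar>"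
    unfolding power_abs[symmetric] abs_mult[symmetric] using x t
    by (intro arg_cong[where f = abs]) (simp add: field_simps power2_eq_square)
  have "f1 a b t x = sqrt ((\<bar>x + a\<bar> * \<bar>x - 1/a\<bar>) / ((\<bar>x + 1/b\<bar> * \<bar>x - b\<bar>)
      * \<bar>(x\<^sup>2 - t\<^sup>2) * (x\<^sup>2 - t powr (-2))\<bar>))"
    unfolding f1_def by (simp only: powr_half_eq_sqrt abs_ge_zero real_sqrt_mult real_sqrt_divide) simp
  also have "\<dots> = sqrt ((\<bar>?u + (a - 1/a)\<bar> / (\<bar>?u - (b - 1/b)\<bar> * \<bar>?u\<^sup>2 - (t - 1/t)\<^sup>2\<bar>)) / \<bar>x\<bar>\<^sup>2)"
    unfolding 1 2 3 using x by (intro arg_cong[where f = sqrt]) (simp add: divide_simps)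
  also have "\<dots> = edge_fun (a - 1/a) (b - 1/b) (t - 1/t) ?u / \<bar>x\<bar>"
    unfolding edge_fun_def by (subst real_sqrt_divide) simp
  finally show ?thesis
    using x by simp
qed

lemma f2_eq_f1: "f2 a b t x = f1 b a t (- x)"
proof -
  have "\<bar>- x + b\<bar> = \<bar>x - b\<bar>" "\<bar>- x + 1/a\<bar> = \<bar>x - 1/a\<bar>"
       "\<bar>- x - 1/b\<bar> = \<bar>x + 1/b\<bar>" "\<bar>- x - a\<bar> = \<bar>x + a\<bar>"
    by auto
  then show ?thesis
    unfolding f1_def f2_def by (simp only: power2_minus mult_ac)
qed

lemma f2_edge_fun:
  assumes x: "x \<noteq> 0" and a: "a > 0" and b: "b > 0" and t: "t > 0"
  shows "f2 a b t x * \<bar>x\<bar> = edge_fun (b - 1/b) (a - 1/a) (t - 1/t) (- (x - 1/x))"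
proof -
  have "- x - 1 / (- x) = - (x - 1/x)"
    by simp
  then show ?thesis
    using f1_edge_fun[of "- x" b a t] assms by (simp only: f2_eq_f1) simp
qed

section \<open>The edge lengths as regular integrals\<close>

text \<open>With \<open>A\<close>, \<open>B\<close>, \<open>T\<close> as above, these are \<open>I\<^sub>1\<close>, \<open>I\<^sub>2\<close>, \<open>I\<^sub>3\<close>; exchanging \<open>A\<close> and \<open>B\<close> yields
  \<open>J\<^sub>3\<close>, \<open>J\<^sub>2\<close>, \<open>J\<^sub>1\<close>.\<close>

definition outer_edge :: "real \<Rightarrow> real \<Rightarrow> real \<Rightarrow> real" where
  "outer_edge A B T = integral {0..pi / 2} (\<lambda>\<theta>. 2 * (sin_arc A T \<theta> - A)
     / sqrt ((sin_arc A T \<theta> + B) * (T + sin_arc A T \<theta>) * ((sin_arc A T \<theta>)\<^sup>2 + 4)))"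

definition middle_edge :: "real \<Rightarrow> real \<Rightarrow> real \<Rightarrow> real" where
  "middle_edge A B T = integral {0..pi / 2} (\<lambda>\<theta>. 2 * (A + B) * (sin \<theta>)\<^sup>2
     / sqrt ((T\<^sup>2 - (sin_arc (- A) B \<theta>)\<^sup>2) * ((sin_arc (- A) B \<theta>)\<^sup>2 + 4)))"

definition inner_edge :: "real \<Rightarrow> real \<Rightarrow> real \<Rightarrow> real" where
  "inner_edge A B T = integral {0..pi / 2} (\<lambda>\<theta>. 2 * (sin_arc B T \<theta> + A)
     / sqrt ((sin_arc B T \<theta> + A) * (T + sin_arc B T \<theta>) * ((sin_arc B T \<theta>)\<^sup>2 + 4)))"

section \<open>Positive radicands and continuity in \<open>T\<close>\<close>

lemma sq_plus_4_pos: "0 < u\<^sup>2 + (4 :: real)"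
  by (simp add: add_nonneg_pos)

lemma outer_edge_radicand_pos:
  assumes "0 < A + B" "A \<le> T" "0 < A + T"
  shows "0 < (sin_arc A T \<theta> + B) * (T + sin_arc A T \<theta>) * ((sin_arc A T \<theta>)\<^sup>2 + 4)"
  using assms sin_arc_bounds(1)[of A T \<theta>] by (intro mult_pos_pos sq_plus_4_pos) auto

lemma middle_edge_radicand_pos:
  assumes "0 < A + B" "\<bar>A\<bar> < T" "\<bar>B\<bar> < T"
  shows "0 < (T\<^sup>2 - (sin_arc (- A) B \<theta>)\<^sup>2) * ((sin_arc (- A) B \<theta>)\<^sup>2 + 4)"
proof -
  have "\<bar>sin_arc (- A) B \<theta>\<bar> < \<bar>T\<bar>"
    using assms sin_arc_bounds[of "- A" B \<theta>] by auto
  then have "(sin_arc (- A) B \<theta>)\<^sup>2 < T\<^sup>2"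
    using power_strict_mono[of "\<bar>sin_arc (- A) B \<theta>\<bar>" "\<bar>T\<bar>" 2] by simp
  then show ?thesis
    by (intro mult_pos_pos sq_plus_4_pos) auto
qed

lemma continuous_on_divide_sqrt:
  fixes f g :: "'a::topological_space \<Rightarrow> real"
  assumes "continuous_on S f" "continuous_on S g" "\<And>x. x \<in> S \<Longrightarrow> 0 < g x"
  shows "continuous_on S (\<lambda>x. f x / sqrt (g x))"
  using assms by (force intro!: continuous_intros)

lemma outer_edge_integrand_continuous:
  assumes "0 < A + B"
  shows "continuous_on ({T. A \<le> T \<and> 0 < A + T} \<times> {0..pi / 2})
    (\<lambda>(T, \<theta>). 2 * (sin_arc A T \<theta> - A)
     / sqrt ((sin_arc A T \<theta> + B) * (T + sin_arc A T \<theta>) * ((sin_arc A T \<theta>)\<^sup>2 + 4)))"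
  using outer_edge_radicand_pos[OF assms]
  unfolding case_prod_beta
  by (intro continuous_on_divide_sqrt) (auto intro!: continuous_intros)

lemma inner_edge_integrand_continuous:
  assumes "0 < A + B"
  shows "continuous_on ({T. B \<le> T \<and> 0 < B + T} \<times> {0..pi / 2})
    (\<lambda>(T, \<theta>). 2 * (sin_arc B T \<theta> + A)
     / sqrt ((sin_arc B T \<theta> + A) * (T + sin_arc B T \<theta>) * ((sin_arc B T \<theta>)\<^sup>2 + 4)))"
  using outer_edge_radicand_pos[of B A] assms
  unfolding case_prod_beta
  by (intro continuous_on_divide_sqrt) (auto intro!: continuous_intros)

lemma middle_edge_integrand_continuous:
  assumes "0 < A + B"
  shows "continuous_on ({T. \<bar>A\<bar> < T \<and> \<bar>B\<bar> < T} \<times> {0..pi / 2})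
    (\<lambda>(T, \<theta>). 2 * (A + B) * (sin \<theta>)\<^sup>2
     / sqrt ((T\<^sup>2 - (sin_arc (- A) B \<theta>)\<^sup>2) * ((sin_arc (- A) B \<theta>)\<^sup>2 + 4)))"
  using middle_edge_radicand_pos[OF assms]
  unfolding case_prod_beta
  by (intro continuous_on_divide_sqrt) (auto intro!: continuous_intros)

lemma continuous_on_section:
  assumes "continuous_on (U \<times> V) (\<lambda>(x, y). f x y)" "x \<in> U"
  shows "continuous_on V (f x)"
proof -
  have "continuous_on V (\<lambda>y. (\<lambda>(x, y). f x y) (x, y))"
    by (rule continuous_on_compose2[OF assms(1)]) (use assms(2) in \<open>auto intro!: continuous_intros\<close>)
  then show ?thesis by simp
qed

text \<open>For the outer and inner edges the sets contain the value of \<open>T\<close> at which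
  the interval of \<open>u\<close> shrinks to a point, provided it is positive; this later permits
  compactness on \<open>{B..B + 1}\<close>. For the middle edge the inequalities are strict, since
  at \<open>T = \<bar>A\<bar>\<close> or \<open>T = \<bar>B\<bar>\<close> the radicand vanishes at
  an end of the edge.\<close>

lemma continuous_on_edges:
  assumes "0 < A + B"
  shows "continuous_on {T. A \<le> T \<and> 0 < A + T} (outer_edge A B)"
    and "continuous_on {T. B \<le> T \<and> 0 < B + T} (inner_edge A B)"
    and "continuous_on {T. \<bar>A\<bar> < T \<and> \<bar>B\<bar> < T} (middle_edge A B)"
  unfolding outer_edge_def[abs_def] inner_edge_def[abs_def] middle_edge_def[abs_def]
  using integral_continuous_on_param[OF outer_edge_integrand_continuous[OF assms, folded box_real(2)]]
    integral_continuous_on_param[OF inner_edge_integrand_continuous[OF assms, folded box_real(2)]]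
    integral_continuous_on_param[OF middle_edge_integrand_continuous[OF assms, folded box_real(2)]]
  by simp_all

section \<open>Substitution on each of the three edges\<close>

lemma sqrt_div_mult_squares:
  assumes "0 < s" "0 < c" "0 < k" "0 \<le> d"
  shows "sqrt (k * s\<^sup>2 / (d * (k * c\<^sup>2))) = s / (c * sqrt d)"
proof -
  have "k * s\<^sup>2 / (d * (k * c\<^sup>2)) = s\<^sup>2 / (c\<^sup>2 * d)"
    using assms by (simp add: divide_simps)
  then show ?thesis
    using assms by (simp add: real_sqrt_divide real_sqrt_mult)
qed

text \<open>The edge \<open>[-T, -A]\<close> is traversed from \<open>-A\<close> to
  \<open>-T\<close>, so that the zero of the integrand sits at \<open>\<theta> = 0\<close> and its
  singularity at \<open>pi / 2\<close>. The cosine of the Jacobian cancels that singularity.\<close>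

lemma outer_edge_substitution:
  assumes "0 < A + B" "\<bar>A\<bar> < T" and \<theta>: "\<theta> \<in> {0<..<pi / 2}"
  defines "u \<equiv> sin_arc A T \<theta>"
  shows "edge_fun A B T (- u) / sqrt (u\<^sup>2 + 4) * \<bar>T - A\<bar> * (2 * sin \<theta> * cos \<theta>)
    = 2 * (u - A) / sqrt ((u + B) * (T + u) * (u\<^sup>2 + 4))"
proof -
  note sc = sin_cos_pos[OF \<theta>]
  have k: "0 < T - A" using assms by auto
  have uA: "u - A = (T - A) * (sin \<theta>)\<^sup>2" and uT: "T - u = (T - A) * (cos \<theta>)\<^sup>2"
    by (simp add: u_def sin_arc_def, simp add: u_def sin_arc_cos)
  have b: "A \<le> u" "u \<le> T"
    using sin_arc_bounds[of A T \<theta>] k by (auto simp: u_def)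
  then have pos: "0 < u + B" "0 < T + u"
    using assms by auto
  have "\<bar>- u + A\<bar> = u - A" "\<bar>- u - B\<bar> = u + B"
    using b pos by auto
  moreover have "\<bar>(- u)\<^sup>2 - T\<^sup>2\<bar> = (T + u) * (T - u)"
    using b pos by (subst abs_minus_commute) (simp add: power2_eq_square square_diff_square_factored mult.commute)
  ultimately have "edge_fun A B T (- u)
      = sqrt ((T - A) * (sin \<theta>)\<^sup>2 / (((u + B) * (T + u)) * ((T - A) * (cos \<theta>)\<^sup>2)))"
    by (simp add: edge_fun_def uA uT mult.assoc)
  also have "\<dots> = sin \<theta> / (cos \<theta> * sqrt ((u + B) * (T + u)))"
    using sc k pos by (intro sqrt_div_mult_squares) auto
  finally have "edge_fun A B T (- u) / sqrt (u\<^sup>2 + 4) * \<bar>T - A\<bar> * (2 * sin \<theta> * cos \<theta>)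
      = 2 * ((T - A) * (sin \<theta>)\<^sup>2) / (sqrt ((u + B) * (T + u)) * sqrt (u\<^sup>2 + 4))"
    using sc k pos by (simp add: power2_eq_square)
  then show ?thesis
    by (simp only: uA real_sqrt_mult)
qed

text \<open>Here both ends are inverse square root singularities, and
  \<open>sin \<theta> * cos \<theta>\<close> cancels both.\<close>

lemma inner_edge_substitution:
  assumes "0 < A + B" "\<bar>B\<bar> < T" and \<theta>: "\<theta> \<in> {0<..<pi / 2}"
  defines "u \<equiv> sin_arc B T \<theta>"
  shows "edge_fun A B T u / sqrt (u\<^sup>2 + 4) * \<bar>T - B\<bar> * (2 * sin \<theta> * cos \<theta>)
    = 2 * (u + A) / sqrt ((u + A) * (T + u) * (u\<^sup>2 + 4))"
proof -
  note sc = sin_cos_pos[OF \<theta>]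
  have k: "0 < T - B" using assms by auto
  have uB: "u - B = (T - B) * (sin \<theta>)\<^sup>2" and uT: "T - u = (T - B) * (cos \<theta>)\<^sup>2"
    by (simp add: u_def sin_arc_def, simp add: u_def sin_arc_cos)
  have b: "B \<le> u" "u \<le> T"
    using sin_arc_bounds[of B T \<theta>] k by (auto simp: u_def)
  then have pos: "0 < u + A" "0 < T + u"
    using assms by auto
  have "\<bar>u + A\<bar> = u + A" "\<bar>u - B\<bar> = u - B"
    using b pos by auto
  moreover have "\<bar>u\<^sup>2 - T\<^sup>2\<bar> = (T + u) * (T - u)"
    using b pos by (subst abs_minus_commute) (simp add: power2_eq_square square_diff_square_factored mult.commute)
  ultimately have "edge_fun A B T u
      = sqrt ((u + A) / ((T + u) * ((T - B) * (sin \<theta>) * (cos \<theta>))\<^sup>2))"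
    by (simp add: edge_fun_def uB uT power2_eq_square mult_ac)
  also have "\<dots> = sqrt (u + A) / (sqrt (T + u) * ((T - B) * sin \<theta> * cos \<theta>))"
    using sc k by (simp add: real_sqrt_divide real_sqrt_mult)
  finally have "edge_fun A B T u / sqrt (u\<^sup>2 + 4) * \<bar>T - B\<bar> * (2 * sin \<theta> * cos \<theta>)
      = 2 * sqrt (u + A) / (sqrt (T + u) * sqrt (u\<^sup>2 + 4))"
    using sc k by simp
  \<comment> \<open>Expanding by \<open>sqrt (u + A)\<close> produces the denominator of
    \<open>outer_edge B A\<close>, so that the two kinds of edges can later be compared through
    their numerators.\<close>
  also have "\<dots> = 2 * (sqrt (u + A) * sqrt (u + A)) / (sqrt (u + A) * sqrt (T + u) * sqrt (u\<^sup>2 + 4))"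
    using pos by (simp add: divide_simps)
  also have "sqrt (u + A) * sqrt (u + A) = u + A"
    using pos by simp
  finally show ?thesis
    by (simp only: real_sqrt_mult)
qed

lemma middle_edge_substitution:
  assumes "0 < A + B" "\<bar>A\<bar> < T" "\<bar>B\<bar> < T" and \<theta>: "\<theta> \<in> {0<..<pi / 2}"
  defines "u \<equiv> sin_arc (- A) B \<theta>"
  shows "edge_fun A B T u / sqrt (u\<^sup>2 + 4) * \<bar>A + B\<bar> * (2 * sin \<theta> * cos \<theta>)
    = 2 * (A + B) * (sin \<theta>)\<^sup>2 / sqrt ((T\<^sup>2 - u\<^sup>2) * (u\<^sup>2 + 4))"
proof -
  note sc = sin_cos_pos[OF \<theta>]
  have uA: "u + A = (A + B) * (sin \<theta>)\<^sup>2" and uB: "B - u = (A + B) * (cos \<theta>)\<^sup>2"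
    by (simp add: u_def sin_arc_def algebra_simps, simp add: u_def sin_arc_cos algebra_simps)
  have "0 < (T\<^sup>2 - u\<^sup>2) * (u\<^sup>2 + 4)"
    unfolding u_def by (rule middle_edge_radicand_pos) (use assms in auto)
  then have pos: "0 < T\<^sup>2 - u\<^sup>2"
    using sq_plus_4_pos[of u] by (simp add: zero_less_mult_iff)
  have "\<bar>u + A\<bar> = (A + B) * (sin \<theta>)\<^sup>2" "\<bar>u - B\<bar> = (A + B) * (cos \<theta>)\<^sup>2"
    using assms(1) by (simp add: uA, subst abs_minus_commute, simp add: uB)
  then have "edge_fun A B T u
      = sqrt ((A + B) * (sin \<theta>)\<^sup>2 / ((T\<^sup>2 - u\<^sup>2) * ((A + B) * (cos \<theta>)\<^sup>2)))"
    using pos by (simp add: edge_fun_def mult.commute)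
  also have "\<dots> = sin \<theta> / (cos \<theta> * sqrt (T\<^sup>2 - u\<^sup>2))"
    using sc assms(1) pos by (intro sqrt_div_mult_squares) auto
  finally have "edge_fun A B T u / sqrt (u\<^sup>2 + 4) * \<bar>A + B\<bar> * (2 * sin \<theta> * cos \<theta>)
      = 2 * (A + B) * (sin \<theta>)\<^sup>2 / (sqrt (T\<^sup>2 - u\<^sup>2) * sqrt (u\<^sup>2 + 4))"
    using sc assms(1) by (simp add: power2_eq_square)
  then show ?thesis
    by (simp only: real_sqrt_mult)
qed

section \<open>Order of the vertices and identification of the edge lengths\<close>

lemma diff_inverse_strict_mono:
  fixes x y :: real
  assumes "0 < x" "x < y"
  shows "x - 1 / x < y - 1 / y"
proof -
  have "1 / y < 1 / x"
    using assms by (simp add: frac_less2)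
  then show ?thesis using assms by linarith
qed

text \<open>The map \<open>x - 1/x\<close> increases on the positive reals and changes sign under
  \<open>x \<mapsto> 1/x\<close>. Hence \<open>-A\<close> and \<open>-B\<close> are its values at
  \<open>1/a\<close> and \<open>1/b\<close>, and everything follows from \<open>1/b < a < t\<close>
  and \<open>1/a < b < t\<close>.\<close>

lemma vertex_order:
  fixes a b t :: real
  assumes "0 < a" "0 < b" "1 < a * b" "a < t" "b < t"
  shows "0 < (a - 1/a) + (b - 1/b)" "\<bar>a - 1/a\<bar> < t - 1/t" "\<bar>b - 1/b\<bar> < t - 1/t"
proof -
  have ba: "1 / b < a" "1 / a < b"
    using assms by (simp_all add: field_simps)
  show "0 < (a - 1/a) + (b - 1/b)"
    using diff_inverse_strict_mono[OF _ ba(1)] assms by simp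
  show "\<bar>a - 1/a\<bar> < t - 1/t"
    using diff_inverse_strict_mono[of a t] diff_inverse_strict_mono[of "1/a" t] ba assms by auto
  show "\<bar>b - 1/b\<bar> < t - 1/t"
    using diff_inverse_strict_mono[of b t] diff_inverse_strict_mono[of "1/b" t] ba assms by auto
qed

lemma edge_lengths:
  fixes a b t :: real
  assumes ab: "0 < a" "0 < b" "1 < a * b" "a < t" "b < t"
  defines "A \<equiv> a - 1/a" and "B \<equiv> b - 1/b" and "T \<equiv> t - 1/t"
  shows "Iint a b t 1 = outer_edge A B T" "Iint a b t 2 = middle_edge A B T"
    "Iint a b t 3 = inner_edge A B T" "Jint a b t 1 = inner_edge B A T"
    "Jint a b t 2 = middle_edge B A T" "Jint a b t 3 = outer_edge B A T"
proof -
  have AB: "0 < A + B" "0 < B + A" and AT: "\<bar>A\<bar> < T" and BT: "\<bar>B\<bar> < T"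
    using vertex_order[OF ab] by (simp_all add: A_def B_def T_def)
  have X: "neg_branch (- T) = - t" "neg_branch (- A) = - a" "neg_branch B = - 1 / b" "neg_branch T = - 1 / t"
    using neg_branch_unique[of "- t"] neg_branch_unique[of "- a"]
      neg_branch_unique[of "- 1 / b"] neg_branch_unique[of "- 1 / t"] ab
    by (simp_all add: A_def B_def T_def)
  \<comment> \<open>The middle segment is needed in both directions: the zero at
    \<open>\<theta> = 0\<close> is \<open>-A\<close> for \<open>f1\<close> but \<open>B\<close> for
    \<open>f2\<close>. On the first edge the order covers the sign change in
    \<open>sin_arc_uminus\<close>.\<close>
  have seg: "{- t..- a} = closed_segment (neg_branch (- A)) (neg_branch (- T))"
    "{- a..- 1 / b} = closed_segment (neg_branch (- A)) (neg_branch B)"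
    "{- a..- 1 / b} = closed_segment (neg_branch B) (neg_branch (- A))"
    "{- 1 / b..- 1 / t} = closed_segment (neg_branch B) (neg_branch T)"
    using ab AB AT BT neg_branch_mono[of "- T" "- A"] neg_branch_mono[of "- A" B] neg_branch_mono[of B T]
    by (auto simp: closed_segment_eq_real_ivl X)
  have F1: "f1 a b t x * \<bar>x\<bar> = edge_fun A B T (x - 1 / x)" if "x < 0" for x
    using f1_edge_fun[of x a b t] that ab by (simp add: A_def B_def T_def)
  have F2: "f2 a b t x * \<bar>x\<bar> = edge_fun B A T (- (x - 1 / x))" if "x < 0" for x
    using f2_edge_fun[of x a b t] that ab by (simp add: A_def B_def T_def)
  have T_sets: "T \<in> {T. A \<le> T \<and> 0 < A + T}" "T \<in> {T. B \<le> T \<and> 0 < B + T}"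
    "T \<in> {T. \<bar>A\<bar> < T \<and> \<bar>B\<bar> < T}" "T \<in> {T. \<bar>B\<bar> < T \<and> \<bar>A\<bar> < T}"
    using AT BT by auto
  note c1 = continuous_on_section[OF outer_edge_integrand_continuous]
  note c2 = continuous_on_section[OF middle_edge_integrand_continuous]
  note c3 = continuous_on_section[OF inner_edge_integrand_continuous]
  have "Iint a b t 1 = integral {- t..- a} (f1 a b t)" "Iint a b t 2 = integral {- a..- 1 / b} (f1 a b t)"
    "Iint a b t 3 = integral {- 1 / b..- 1 / t} (f1 a b t)" "Jint a b t 1 = integral {- t..- a} (f2 a b t)"
    "Jint a b t 2 = integral {- a..- 1 / b} (f2 a b t)" "Jint a b t 3 = integral {- 1 / b..- 1 / t} (f2 a b t)"
    by (simp_all add: Iint_def Jint_def vtx_def)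
  note edges = this(1)[unfolded seg(1)] this(2)[unfolded seg(2)] this(3)[unfolded seg(4)]
    this(4)[unfolded seg(1)] this(5)[unfolded seg(3)] this(6)[unfolded seg(4)]
  show "Iint a b t 1 = outer_edge A B T"
    unfolding edges outer_edge_def
    by (rule integral_substitution_sin_arc[OF _ c1[OF AB(1) T_sets(1)] F1])
      (use outer_edge_substitution[OF AB(1) AT] AT in \<open>auto simp: sin_arc_uminus abs_minus_commute\<close>)
  show "Iint a b t 2 = middle_edge A B T"
    unfolding edges middle_edge_def
    by (rule integral_substitution_sin_arc[OF _ c2[OF AB(1) T_sets(3)] F1])
      (use middle_edge_substitution[OF AB(1) AT BT] AB in \<open>auto simp: add.commute\<close>)
  show "Iint a b t 3 = inner_edge A B T"
    unfolding edges inner_edge_def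
    by (rule integral_substitution_sin_arc[OF _ c3[OF AB(1) T_sets(2)] F1])
      (use inner_edge_substitution[OF AB(1) BT] BT in auto)
  show "Jint a b t 1 = inner_edge B A T"
    unfolding edges inner_edge_def
    by (rule integral_substitution_sin_arc[OF _ c3[OF AB(2) T_sets(1)] F2])
      (use inner_edge_substitution[OF AB(2) AT] AT in \<open>auto simp: sin_arc_uminus abs_minus_commute\<close>)
  show "Jint a b t 2 = middle_edge B A T"
    unfolding edges middle_edge_def
    by (rule integral_substitution_sin_arc[OF _ c2[OF AB(2) T_sets(4)] F2])
      (use middle_edge_substitution[OF AB(2) BT AT] AB sin_arc_uminus[of B "- A"] sin_arc_uminus[of "- B" A] in
        \<open>auto simp: add.commute abs_minus_commute\<close>)
  show "Jint a b t 3 = outer_edge B A T"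
    unfolding edges outer_edge_def
    by (rule integral_substitution_sin_arc[OF _ c1[OF AB(2) T_sets(2)] F2])
      (use outer_edge_substitution[OF AB(2) BT] BT in auto)
qed

section \<open>Positivity of the edge lengths\<close>

lemma integral_pos_real:
  fixes f :: "real \<Rightarrow> real"
  assumes "a < b" "continuous_on {a..b} f" "\<And>x. x \<in> {a<..<b} \<Longrightarrow> 0 < f x"
  shows "0 < integral {a..b} f"
proof -
  have "integral {a..b} (\<lambda>x. 0) < integral {a..b} f"
    by (rule integral_less_real) (use assms in \<open>auto intro: dense\<close>)
  then show ?thesis by simp
qed

lemma edge_sections:
  assumes "0 < A + B"
  shows "A \<le> T \<Longrightarrow> 0 < A + T \<Longrightarrow> continuous_on {0..pi / 2} (\<lambda>\<theta>. 2 * (sin_arc A T \<theta> - A)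
     / sqrt ((sin_arc A T \<theta> + B) * (T + sin_arc A T \<theta>) * ((sin_arc A T \<theta>)\<^sup>2 + 4)))"
  and "B \<le> T \<Longrightarrow> 0 < B + T \<Longrightarrow> continuous_on {0..pi / 2} (\<lambda>\<theta>. 2 * (sin_arc B T \<theta> + A)
     / sqrt ((sin_arc B T \<theta> + A) * (T + sin_arc B T \<theta>) * ((sin_arc B T \<theta>)\<^sup>2 + 4)))"
  and "\<bar>A\<bar> < T \<Longrightarrow> \<bar>B\<bar> < T \<Longrightarrow> continuous_on {0..pi / 2} (\<lambda>\<theta>. 2 * (A + B) * (sin \<theta>)\<^sup>2
     / sqrt ((T\<^sup>2 - (sin_arc (- A) B \<theta>)\<^sup>2) * ((sin_arc (- A) B \<theta>)\<^sup>2 + 4)))"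
  using continuous_on_section[OF outer_edge_integrand_continuous[OF assms]]
    continuous_on_section[OF inner_edge_integrand_continuous[OF assms]]
    continuous_on_section[OF middle_edge_integrand_continuous[OF assms]]
  by auto

lemma outer_edge_nonneg:
  assumes "0 < A + B" "A \<le> T" "0 < A + T"
  shows "0 \<le> outer_edge A B T"
  unfolding outer_edge_def
proof (rule integral_nonneg[OF integrable_continuous_real[OF edge_sections(1)[OF assms]]])
  fix \<theta>
  show "0 \<le> 2 * (sin_arc A T \<theta> - A) / sqrt ((sin_arc A T \<theta> + B) * (T + sin_arc A T \<theta>) * ((sin_arc A T \<theta>)\<^sup>2 + 4))"
    using outer_edge_radicand_pos[OF assms, of \<theta>] sin_arc_bounds(1)[OF assms(2), of \<theta>] by (intro divide_nonneg_nonneg) auto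
qed

lemma inner_edge_pos:
  assumes "0 < A + B" "B \<le> T" "0 < B + T"
  shows "0 < inner_edge A B T"
  unfolding inner_edge_def
proof (rule integral_pos_real[OF _ edge_sections(2)[OF assms]])
  fix \<theta>
  show "0 < 2 * (sin_arc B T \<theta> + A) / sqrt ((sin_arc B T \<theta> + A) * (T + sin_arc B T \<theta>) * ((sin_arc B T \<theta>)\<^sup>2 + 4))"
    using outer_edge_radicand_pos[of B A T \<theta>] sin_arc_bounds(1)[OF assms(2), of \<theta>] assms
    by (intro divide_pos_pos) auto
qed simp

lemma middle_edge_pos:
  assumes "0 < A + B" "\<bar>A\<bar> < T" "\<bar>B\<bar> < T"
  shows "0 < middle_edge A B T"
  unfolding middle_edge_def
proof (rule integral_pos_real[OF _ edge_sections(3)[OF assms]])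
  fix \<theta> :: real assume "\<theta> \<in> {0<..<pi / 2}"
  then have "0 < (sin \<theta>)\<^sup>2"
    using sin_cos_pos[of \<theta>] by simp
  then show "0 < 2 * (A + B) * (sin \<theta>)\<^sup>2 / sqrt ((T\<^sup>2 - (sin_arc (- A) B \<theta>)\<^sup>2) * ((sin_arc (- A) B \<theta>)\<^sup>2 + 4))"
    using middle_edge_radicand_pos[OF assms, of \<theta>] assms(1) by (intro divide_pos_pos mult_pos_pos) auto
qed simp

section \<open>The limit \<open>T \<rightarrow> B\<close>\<close>

text \<open>Near \<open>u = B\<close> the integrand dominates a multiple of the derivative of
  \<open>- ln (T - u)\<close>. Restriction to \<open>{pi / 6..pi / 2}\<close> keeps
  \<open>sin \<theta> \<ge> 1/2\<close>, and \<open>3/4\<close> is the square of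
  \<open>cos (pi / 6)\<close>.\<close>

lemma middle_edge_ge_log:
  assumes AB: "0 < A + B" "\<bar>A\<bar> < B" and T: "B < T" "T \<le> B + 1"
  shows "sqrt (A + B) / (2 * sqrt ((2 * B + 1) * (B\<^sup>2 + 4))) * (ln (3 / 4 * (A + B)) - ln (T - B))
    \<le> middle_edge A B T"
proof -
  define C R where "C = A + B" and "R = sqrt ((2 * B + 1) * (B\<^sup>2 + 4))"
  define u where "u = sin_arc (- A) B"
  define k where "k \<theta> = 2 * C * sin \<theta> * cos \<theta> / (T - u \<theta>)" for \<theta>
  define F where "F \<theta> = 2 * (A + B) * (sin \<theta>)\<^sup>2 / sqrt ((T\<^sup>2 - (u \<theta>)\<^sup>2) * ((u \<theta>)\<^sup>2 + 4))" for \<theta>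
  have C: "0 < C" and B: "0 < B" and R: "0 < R"
    using AB by (auto simp: C_def R_def intro!: mult_pos_pos sq_plus_4_pos)
  have u: "- A \<le> u \<theta>" "u \<theta> \<le> B" for \<theta>
    unfolding u_def using sin_arc_bounds[of "- A" B \<theta>] AB by auto
  have Tu: "T - u \<theta> = (T - B) + C * (cos \<theta>)\<^sup>2" for \<theta>
    by (simp add: u_def C_def sin_arc_cos algebra_simps)
  have "(k has_integral (- ln (T - u (pi / 2)) - - ln (T - u (pi / 6)))) {pi / 6..pi / 2}"
  proof (rule fundamental_theorem_of_calculus)
    fix \<theta> assume "\<theta> \<in> {pi / 6..pi / 2}"
    have "0 < T - u \<theta>" using u(2)[of \<theta>] T by linarith
    then have "((\<lambda>\<theta>. - ln (T - u \<theta>)) has_real_derivative k \<theta>) (at \<theta> within {pi / 6..pi / 2})"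
      unfolding u_def k_def C_def
      by (auto intro!: derivative_eq_intros sin_arc_has_derivative simp: add.commute)
    then show "((\<lambda>\<theta>. - ln (T - u \<theta>)) has_vector_derivative k \<theta>) (at \<theta> within {pi / 6..pi / 2})"
      by (simp add: has_real_derivative_iff_has_vector_derivative)
  qed simp
  from has_integral_mult_right[OF this, of "sqrt C / (2 * R)"]
  have int_k: "((\<lambda>\<theta>. sqrt C / (2 * R) * k \<theta>) has_integral
      sqrt C / (2 * R) * (ln (T - u (pi / 6)) - ln (T - B))) {pi / 6..pi / 2}"
    by (simp add: u_def)
  have F_cont: "continuous_on {0..pi / 2} F"
    unfolding F_def u_def using edge_sections(3)[OF AB(1), of T] AB T by auto
  have F_int: "F integrable_on {0..pi / 2}" "F integrable_on {pi / 6..pi / 2}"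
    by (auto intro!: integrable_continuous_real continuous_on_subset[OF F_cont])
  have F_nonneg: "0 \<le> F \<theta>" for \<theta>
    unfolding F_def u_def using middle_edge_radicand_pos[OF AB(1), of T \<theta>] AB T
    by (intro divide_nonneg_nonneg mult_nonneg_nonneg) auto
  \<comment> \<open>With \<open>w^2 = T - u\<close>, one quotient
    \<open>sqrt C * cos \<theta> / w \<le> 1 \<le> 2 * sin \<theta>\<close> is given away;
    \<open>R\<close> bounds the regular factor \<open>(T + u) (u^2 + 4)\<close> by means of
    \<open>T \<le> B + 1\<close> and \<open>\<bar>u\<bar> \<le> B\<close>.\<close>
  have k_le: "sqrt C / (2 * R) * k \<theta> \<le> F \<theta>" if \<theta>: "\<theta> \<in> {pi / 6..pi / 2}" for \<theta>
  proof -
    define w where "w = sqrt (T - u \<theta>)"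
    have Tu_pos: "0 < T - u \<theta>" using u(2)[of \<theta>] T by linarith
    then have w: "0 < w" "w * w = T - u \<theta>" by (simp_all add: w_def)
    have "sin (pi / 6) \<le> sin \<theta>"
      by (rule sin_monotone_2pi_le) (use \<theta> pi_gt_zero in auto)
    then have s: "1 / 2 \<le> sin \<theta>" by (simp add: sin_30)
    have c: "0 \<le> cos \<theta>"
      using \<theta> pi_gt_zero by (intro cos_ge_zero) auto
    have "sqrt (C * (cos \<theta>)\<^sup>2) \<le> w"
      unfolding w_def Tu using T by simp
    then have cw: "sqrt C * cos \<theta> \<le> w"
      using c by (simp add: real_sqrt_mult)
    have "(u \<theta>)\<^sup>2 \<le> B\<^sup>2"
      using u[of \<theta>] AB by (intro power2_le_iff_abs_le[THEN iffD2]) auto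
    then have "(T + u \<theta>) * ((u \<theta>)\<^sup>2 + 4) \<le> (2 * B + 1) * (B\<^sup>2 + 4)"
      using u[of \<theta>] T AB by (intro mult_mono) auto
    then have "(T - u \<theta>) * ((T + u \<theta>) * ((u \<theta>)\<^sup>2 + 4)) \<le> (T - u \<theta>) * ((2 * B + 1) * (B\<^sup>2 + 4))"
      using Tu_pos by (intro mult_left_mono) auto
    then have "sqrt ((T\<^sup>2 - (u \<theta>)\<^sup>2) * ((u \<theta>)\<^sup>2 + 4)) \<le> sqrt ((T - u \<theta>) * ((2 * B + 1) * (B\<^sup>2 + 4)))"
      by (simp add: power2_eq_square square_diff_square_factored mult_ac)
    then have rad: "sqrt ((T\<^sup>2 - (u \<theta>)\<^sup>2) * ((u \<theta>)\<^sup>2 + 4)) \<le> w * R"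
      unfolding w_def R_def by (simp only: real_sqrt_mult)
    have "sqrt C / (2 * R) * k \<theta> = (C * sin \<theta> / (R * w)) * (sqrt C * cos \<theta> / w)"
      unfolding k_def w(2)[symmetric] using w R by (simp add: field_simps)
    also have "\<dots> \<le> (C * sin \<theta> / (R * w)) * (2 * sin \<theta>)"
    proof (rule mult_left_mono)
      have "sqrt C * cos \<theta> / w \<le> 1"
        using cw w by (simp add: divide_simps)
      then show "sqrt C * cos \<theta> / w \<le> 2 * sin \<theta>" using s by linarith
      show "0 \<le> C * sin \<theta> / (R * w)"
        using C s R w by (intro divide_nonneg_nonneg mult_nonneg_nonneg) auto
    qed
    also have "\<dots> = 2 * C * (sin \<theta>)\<^sup>2 / (w * R)"
      by (simp add: power2_eq_square mult_ac)
    also have "\<dots> \<le> 2 * C * (sin \<theta>)\<^sup>2 / sqrt ((T\<^sup>2 - (u \<theta>)\<^sup>2) * ((u \<theta>)\<^sup>2 + 4))"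
      using rad C middle_edge_radicand_pos[OF AB(1), of T \<theta>] AB T
      by (intro divide_left_mono mult_pos_pos[OF mult_pos_pos[OF w(1) R]])
        (auto simp: u_def intro!: mult_nonneg_nonneg)
    finally show ?thesis
      by (simp add: F_def C_def)
  qed
  have "3 / 4 * C \<le> T - u (pi / 6)"
    using T by (simp add: Tu cos_30 power_divide)
  then have "sqrt C / (2 * R) * (ln (3 / 4 * C) - ln (T - B))
      \<le> sqrt C / (2 * R) * (ln (T - u (pi / 6)) - ln (T - B))"
    using C R by (intro mult_left_mono) auto
  also have "\<dots> \<le> integral {pi / 6..pi / 2} F"
    by (rule has_integral_le[OF int_k integrable_integral[OF F_int(2)] k_le])
  also have "\<dots> \<le> integral {0..pi / 2} F"
    by (rule integral_subset_le) (use F_int F_nonneg in auto)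
  finally show ?thesis
    by (simp add: C_def R_def F_def[abs_def] u_def middle_edge_def)
qed

text \<open>On \<open>[-B, A]\<close> the factor degenerating as \<open>T\<close> tends to
  \<open>B\<close> is \<open>T + u\<close>, and it does so at the zero \<open>u = -B\<close> of the
  numerator: \<open>T + u \<ge> (A + B) sin^2 \<theta>\<close>, while
  \<open>T - u \<ge> B - A\<close>. So no logarithm appears.\<close>

lemma middle_edge_swapped_le:
  assumes AB: "0 < A + B" "A < B" and T: "B < T"
  shows "middle_edge B A T \<le> pi / 2 * (2 * (A + B) / sqrt ((B - A) * (A + B)))"
proof -
  define K where "K = sqrt ((B - A) * (A + B))"
  have K: "0 < K" using AB by (simp add: K_def)
  have BA: "0 < B + A" "\<bar>B\<bar> < T" "\<bar>A\<bar> < T" using AB T by auto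
  let ?F = "\<lambda>\<theta>. 2 * (B + A) * (sin \<theta>)\<^sup>2
     / sqrt ((T\<^sup>2 - (sin_arc (- B) A \<theta>)\<^sup>2) * ((sin_arc (- B) A \<theta>)\<^sup>2 + 4))"
  have le: "?F \<theta> \<le> 2 * (A + B) / K" if \<theta>: "\<theta> \<in> {0..pi / 2}" for \<theta>
  proof (cases "sin \<theta> = 0")
    case True
    then show ?thesis using AB K by simp
  next
    case False
    then have s: "0 < sin \<theta>" using sin_cos_nonneg(1)[OF \<theta>] by simp
    define u where "u = sin_arc (- B) A \<theta>"
    have u: "u + B = (A + B) * (sin \<theta>)\<^sup>2" "u \<le> A" "- B \<le> u"
      using sin_arc_bounds[of "- B" A \<theta>] AB by (simp_all add: u_def sin_arc_def algebra_simps)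
    have "((B - A) * ((A + B) * (sin \<theta>)\<^sup>2)) * 1 \<le> ((T - u) * (T + u)) * (u\<^sup>2 + 4)"
      using u AB T by (intro mult_mono mult_nonneg_nonneg) auto
    then have "((B - A) * (A + B)) * (sin \<theta>)\<^sup>2 \<le> (T\<^sup>2 - u\<^sup>2) * (u\<^sup>2 + 4)"
      by (simp add: power2_eq_square square_diff_square_factored mult_ac)
    then have "sqrt (((B - A) * (A + B)) * (sin \<theta>)\<^sup>2) \<le> sqrt ((T\<^sup>2 - u\<^sup>2) * (u\<^sup>2 + 4))"
      by (rule real_sqrt_le_mono)
    then have rad: "K * sin \<theta> \<le> sqrt ((T\<^sup>2 - u\<^sup>2) * (u\<^sup>2 + 4))"
      using s unfolding K_def by (subst (asm) real_sqrt_mult) simp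
    have "?F \<theta> \<le> 2 * (B + A) * (sin \<theta>)\<^sup>2 / (K * sin \<theta>)"
      unfolding u_def[symmetric] using rad K s AB middle_edge_radicand_pos[OF BA, of \<theta>]
      by (intro divide_left_mono mult_pos_pos) (auto simp: u_def)
    also have "\<dots> = 2 * (A + B) / K * sin \<theta>"
      using s K by (simp add: power2_eq_square field_simps)
    also have "\<dots> \<le> 2 * (A + B) / K * 1"
      using AB K by (intro mult_left_mono) auto
    finally show ?thesis by simp
  qed
  have "middle_edge B A T \<le> integral {0..pi / 2} (\<lambda>_. 2 * (A + B) / K)"
    unfolding middle_edge_def
    by (rule integral_le[OF integrable_continuous_real[OF edge_sections(3)[OF BA]] _ le]) auto
  then show ?thesis by (simp add: K_def)
qed

text \<open>The numerator of \<open>Q\<close> over the positive common denominator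
  \<open>I_2 J_2\<close>.\<close>

definition period_defect :: "real \<Rightarrow> real \<Rightarrow> real \<Rightarrow> real" where
  "period_defect A B T = (outer_edge A B T + inner_edge A B T) * middle_edge B A T
    - (inner_edge B A T + outer_edge B A T) * middle_edge A B T"

lemma period_defect_neg:
  assumes AB: "0 < A + B" "A < B"
  shows "\<exists>T>B. period_defect A B T < 0"
proof -
  have A: "\<bar>A\<bar> < B" "0 < B" "0 < B + A" using AB by auto
  \<comment> \<open>The regular integrals for \<open>I_1\<close>, \<open>I_3\<close> and, below,
    \<open>J_1\<close> are continuous up to \<open>T = B\<close> inclusive, so compactness yields
    bounds independent of \<open>T\<close>.\<close>
  have "continuous_on {B..B + 1} (\<lambda>T. outer_edge A B T + inner_edge A B T)"
    by (intro continuous_on_add continuous_on_subset[OF continuous_on_edges(1)[OF AB(1)]]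
        continuous_on_subset[OF continuous_on_edges(2)[OF AB(1)]]) (use A in auto)
  from continuous_attains_sup[OF _ _ this]
  have "\<exists>x\<in>{B..B + 1}. \<forall>T\<in>{B..B + 1}.
      outer_edge A B T + inner_edge A B T \<le> outer_edge A B x + inner_edge A B x"
    by simp
  then obtain M1 where M1: "\<And>T. T \<in> {B..B + 1} \<Longrightarrow> outer_edge A B T + inner_edge A B T \<le> M1"
    by blast
  have "continuous_on {B..B + 1} (inner_edge B A)"
    by (rule continuous_on_subset[OF continuous_on_edges(2)[OF A(3)]]) (use A in auto)
  from continuous_attains_inf[OF _ _ this]
  have "\<exists>x\<in>{B..B + 1}. \<forall>T\<in>{B..B + 1}. inner_edge B A x \<le> inner_edge B A T"
    by simp
  then obtain T0 where T0: "T0 \<in> {B..B + 1}" "\<And>T. T \<in> {B..B + 1} \<Longrightarrow> inner_edge B A T0 \<le> inner_edge B A T"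
    by blast
  define m where "m = inner_edge B A T0"
  have m: "0 < m"
    unfolding m_def by (rule inner_edge_pos) (use A T0 in auto)
  define M2 where "M2 = pi / 2 * (2 * (A + B) / sqrt ((B - A) * (A + B)))"
  define c where "c = sqrt (A + B) / (2 * sqrt ((2 * B + 1) * (B\<^sup>2 + 4)))"
  have c: "0 < c"
    unfolding c_def using A AB by (intro divide_pos_pos mult_pos_pos) (auto intro!: mult_pos_pos sq_plus_4_pos)
  \<comment> \<open>\<open>N\<close> is chosen with \<open>m * N = M1 * M2 + 1\<close>. Then
    \<open>d\<close> makes the logarithmic lower bound for \<open>I_2\<close> at least
    \<open>N\<close>, the minimum with \<open>1\<close> keeping \<open>T\<close> in the compact
    interval.\<close>
  define N where "N = (M1 * M2 + 1) / m"
  define d where "d = min 1 (exp (ln (3 / 4 * (A + B)) - N / c))"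
  define T where "T = B + d"
  have d: "0 < d" "d \<le> 1" by (auto simp: d_def)
  have "ln d \<le> ln (exp (ln (3 / 4 * (A + B)) - N / c))"
    using d by (subst ln_le_cancel_iff) (auto simp: d_def)
  then have "N / c \<le> ln (3 / 4 * (A + B)) - ln (T - B)"
    by (simp add: T_def)
  then have "N \<le> c * (ln (3 / 4 * (A + B)) - ln (T - B))"
    using c by (simp add: divide_simps mult.commute)
  also have "\<dots> \<le> middle_edge A B T"
    unfolding c_def by (rule middle_edge_ge_log) (use AB A d in \<open>auto simp: T_def\<close>)
  finally have mid: "N \<le> middle_edge A B T" .
  have T: "B < T" "T \<in> {B..B + 1}" using d by (auto simp: T_def)
  have I_nonneg: "0 \<le> outer_edge A B T + inner_edge A B T"
    using outer_edge_nonneg[OF AB(1), of T] inner_edge_pos[OF AB(1), of T] A T by auto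
  have J3: "0 \<le> outer_edge B A T"
    by (rule outer_edge_nonneg) (use A T in auto)
  have J2: "0 \<le> middle_edge B A T" "middle_edge B A T \<le> M2"
    using middle_edge_pos[OF A(3), of T] A T middle_edge_swapped_le[OF AB T(1)] by (auto simp: M2_def)
  have I2: "0 < middle_edge A B T"
    by (rule middle_edge_pos[OF AB(1)]) (use A T in auto)
  have "(outer_edge A B T + inner_edge A B T) * middle_edge B A T \<le> M1 * M2"
    using I_nonneg J2 M1[OF T(2)] by (intro mult_mono) auto
  also have "\<dots> < m * N" using m by (simp add: N_def)
  also have "\<dots> \<le> m * middle_edge A B T"
    using mid m by simp
  also have "\<dots> \<le> (inner_edge B A T + outer_edge B A T) * middle_edge A B T"
    using T0(2)[OF T(2)] J3 I2 by (intro mult_right_mono) (auto simp: m_def)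
  finally show ?thesis
    using T(1) by (auto simp: period_defect_def)
qed

section \<open>The limit \<open>T \<rightarrow> \<infinity>\<close>\<close>

text \<open>The comparison function \<open>k\<close> is the derivative of \<open>ln (u + 2)\<close>.
  It is reached by \<open>sqrt (u^2 + 4) \<le> u + 2\<close>, by \<open>u - B \<le> u + A\<close>
  and by \<open>(T - u) (T + u) \<le> T^2\<close>.\<close>

lemma inner_edge_ge_log:
  assumes AB: "0 < A + B" "0 < B" and T: "B < T"
  shows "ln (T + 2) - ln (B + 2) \<le> T * inner_edge A B T"
proof -
  define u where "u = sin_arc B T"
  define k where "k \<theta> = 2 * (T - B) * sin \<theta> * cos \<theta> / (u \<theta> + 2)" for \<theta>
  define F where "F \<theta> = 2 * (u \<theta> + A) / sqrt ((u \<theta> + A) * (T + u \<theta>) * ((u \<theta>)\<^sup>2 + 4))" for \<theta>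
  have u: "B \<le> u \<theta>" "u \<theta> \<le> T" for \<theta>
    unfolding u_def using sin_arc_bounds[of B T \<theta>] T by auto
  have "(k has_integral (ln (u (pi / 2) + 2) - ln (u 0 + 2))) {0..pi / 2}"
  proof (rule fundamental_theorem_of_calculus)
    fix \<theta> assume "\<theta> \<in> {0..pi / 2}"
    have "0 < u \<theta> + 2" using u(1)[of \<theta>] AB by linarith
    then have "((\<lambda>\<theta>. ln (u \<theta> + 2)) has_real_derivative k \<theta>) (at \<theta> within {0..pi / 2})"
      unfolding u_def k_def by (auto intro!: derivative_eq_intros sin_arc_has_derivative)
    then show "((\<lambda>\<theta>. ln (u \<theta> + 2)) has_vector_derivative k \<theta>) (at \<theta> within {0..pi / 2})"
      by (simp add: has_real_derivative_iff_has_vector_derivative)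
  qed simp
  then have int_k: "(k has_integral (ln (T + 2) - ln (B + 2))) {0..pi / 2}"
    by (simp add: u_def)
  have "F integrable_on {0..pi / 2}"
    unfolding F_def u_def using edge_sections(2)[OF AB(1), of T] AB T
    by (intro integrable_continuous_real) auto
  then have int_F: "((\<lambda>\<theta>. T * F \<theta>) has_integral T * integral {0..pi / 2} F) {0..pi / 2}"
    by (intro has_integral_mult_right integrable_integral)
  have "k \<theta> \<le> T * F \<theta>" if \<theta>: "\<theta> \<in> {0..pi / 2}" for \<theta>
  proof -
    define p q r n where "p = sqrt (u \<theta> + A)" and "q = sqrt (T + u \<theta>)" and "r = sqrt ((u \<theta>)\<^sup>2 + 4)"
      and "n = sqrt (T - B)"
    note sc = sin_cos_nonneg[OF \<theta>]
    have uA: "0 < u \<theta> + A" and Tu: "0 < T + u \<theta>" and u2: "0 < u \<theta> + 2"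
      using u(1)[of \<theta>] AB T by linarith+
    have pos: "0 < p" "0 < q" "0 < r" "0 < n"
      using uA Tu T sq_plus_4_pos by (auto simp: p_def q_def r_def n_def)
    have F: "F \<theta> = 2 * p / (q * r)"
    proof -
      have "u \<theta> + A = p * p" using uA by (simp add: p_def)
      then have "F \<theta> = 2 * (p * p) / (p * q * r)"
        unfolding F_def by (simp add: real_sqrt_mult p_def q_def r_def)
      then show ?thesis using pos by (simp add: field_simps)
    qed
    have "(T - B) * (sin \<theta>)\<^sup>2 \<le> u \<theta> + A"
      using AB by (simp add: u_def sin_arc_def)
    then have "sqrt ((T - B) * (sin \<theta>)\<^sup>2) \<le> p"
      unfolding p_def by (rule real_sqrt_le_mono)
    then have ns: "n * sin \<theta> \<le> p"
      using sc by (simp add: n_def real_sqrt_mult)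
    have "r \<le> u \<theta> + 2"
      unfolding r_def using u(1)[of \<theta>] AB by (intro real_le_lsqrt) (auto simp: power2_eq_square algebra_simps)
    have "(T - B) * (cos \<theta>)\<^sup>2 * (T + u \<theta>) = (T - u \<theta>) * (T + u \<theta>)"
      by (simp add: u_def sin_arc_cos)
    also have "\<dots> \<le> T\<^sup>2"
      by (simp add: power2_eq_square algebra_simps)
    finally have "sqrt ((T - B) * (cos \<theta>)\<^sup>2 * (T + u \<theta>)) \<le> sqrt (T\<^sup>2)"
      by (rule real_sqrt_le_mono)
    then have ncq: "n * cos \<theta> * q \<le> T"
      using sc AB T by (simp add: n_def q_def real_sqrt_mult)
    have "k \<theta> = 2 * (n * sin \<theta>) * (n * cos \<theta>) / (u \<theta> + 2)"
      using T by (simp add: k_def n_def mult_ac flip: power2_eq_square)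
    also have "\<dots> \<le> 2 * p * (T / q) / r"
      using ns ncq pos sc u2 \<open>r \<le> u \<theta> + 2\<close> AB T
      by (intro frac_le mult_mono) (auto simp: field_simps)
    also have "\<dots> = T * F \<theta>"
      unfolding F by (simp add: field_simps)
    finally show ?thesis .
  qed
  from has_integral_le[OF int_k int_F this] show ?thesis
    by (simp add: F_def[abs_def] u_def inner_edge_def)
qed

text \<open>\<open>J_3\<close> against \<open>I_3\<close>: the denominators coincide and
  \<open>u - B \<le> u + A\<close>.\<close>

lemma outer_edge_swapped_le_inner_edge:
  assumes AB: "0 < A + B" and T: "B \<le> T" "0 < B + T"
  shows "outer_edge B A T \<le> inner_edge A B T"
  unfolding outer_edge_def inner_edge_def
proof (rule integral_le)
  show "(\<lambda>\<theta>. 2 * (sin_arc B T \<theta> - B) / sqrt ((sin_arc B T \<theta> + A) * (T + sin_arc B T \<theta>) * ((sin_arc B T \<theta>)\<^sup>2 + 4)))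
      integrable_on {0..pi / 2}"
    using edge_sections(1)[of B A T] assms by (intro integrable_continuous_real) auto
  show "(\<lambda>\<theta>. 2 * (sin_arc B T \<theta> + A) / sqrt ((sin_arc B T \<theta> + A) * (T + sin_arc B T \<theta>) * ((sin_arc B T \<theta>)\<^sup>2 + 4)))
      integrable_on {0..pi / 2}"
    using edge_sections(2)[of A B T] assms by (intro integrable_continuous_real) auto
  fix \<theta>
  show "2 * (sin_arc B T \<theta> - B) / sqrt ((sin_arc B T \<theta> + A) * (T + sin_arc B T \<theta>) * ((sin_arc B T \<theta>)\<^sup>2 + 4))
    \<le> 2 * (sin_arc B T \<theta> + A) / sqrt ((sin_arc B T \<theta> + A) * (T + sin_arc B T \<theta>) * ((sin_arc B T \<theta>)\<^sup>2 + 4))"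
    using AB outer_edge_radicand_pos[of B A T \<theta>] assms by (intro divide_right_mono) auto
qed

text \<open>\<open>J_1\<close> against \<open>I_1\<close>: the denominators coincide and the
  numerators differ by the constant \<open>2 (A + B)\<close>, so the difference decays fast enough
  in \<open>u\<close> for the bound to be free of \<open>T\<close>.\<close>

lemma inner_minus_outer_edge_bounded:
  assumes AB: "0 < A + B" "\<bar>A\<bar> < B" and T: "2 * B \<le> T" "B + 1 \<le> T"
  shows "T * (inner_edge B A T - outer_edge A B T)
    \<le> 4 * (A + B) * sqrt (B + 1) * (pi / (2 * sqrt (A + B)) + pi / 2)"
proof -
  define C n where "C = A + B" and "n = sqrt (T - A)"
  define u where "u = sin_arc A T"
  define F G where "F \<theta> = 2 * (u \<theta> + B) / sqrt ((u \<theta> + B) * (T + u \<theta>) * ((u \<theta>)\<^sup>2 + 4))"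
    and "G \<theta> = 2 * (u \<theta> - A) / sqrt ((u \<theta> + B) * (T + u \<theta>) * ((u \<theta>)\<^sup>2 + 4))" for \<theta>
  have C: "0 < C" using AB by (simp add: C_def)
  have n: "1 \<le> n" "n * n = T - A"
    using AB T by (auto simp: n_def)
  have u: "A \<le> u \<theta>" "u \<theta> \<le> T" for \<theta>
    unfolding u_def using sin_arc_bounds[of A T \<theta>] AB T by auto
  have uB: "u \<theta> + B = C + n\<^sup>2 * (sin \<theta>)\<^sup>2" for \<theta>
    using n(2) by (simp add: u_def sin_arc_def C_def power2_eq_square)
  have "F integrable_on {0..pi / 2}" "G integrable_on {0..pi / 2}"
    unfolding F_def G_def u_def
    using edge_sections(1)[of A B T] edge_sections(2)[of B A T] AB T
    by (auto intro!: integrable_continuous_real)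
  then have int_FG: "((\<lambda>\<theta>. T * (F \<theta> - G \<theta>)) has_integral
      T * (integral {0..pi / 2} F - integral {0..pi / 2} G)) {0..pi / 2}"
    by (intro has_integral_mult_right has_integral_diff integrable_integral)
  \<comment> \<open>\<open>h\<close> has the primitive
    \<open>arctan (n / sqrt C * sin \<theta>) / sqrt C\<close>, so its integral stays below
    \<open>pi / (2 * sqrt C)\<close> however large \<open>n\<close> is.\<close>
  define h where "h \<theta> = n * cos \<theta> / (C + n\<^sup>2 * (sin \<theta>)\<^sup>2)" for \<theta>
  have den: "0 < C + n\<^sup>2 * (sin \<theta>)\<^sup>2" for \<theta>
    using C by (simp add: add_pos_nonneg)
  have "(h has_integral (arctan (n / sqrt C * sin (pi / 2)) / sqrt C - arctan (n / sqrt C * sin 0) / sqrt C))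
      {0..pi / 2}"
  proof (rule fundamental_theorem_of_calculus)
    fix \<theta> assume "\<theta> \<in> {0..pi / 2}"
    have "((\<lambda>\<theta>. arctan (n / sqrt C * sin \<theta>) / sqrt C) has_real_derivative
        (inverse (1 + (n / sqrt C * sin \<theta>)\<^sup>2) * (n / sqrt C * cos \<theta>)) / sqrt C) (at \<theta> within {0..pi / 2})"
      by (intro DERIV_cdivide DERIV_chain'[OF DERIV_cmult DERIV_arctan]
          has_field_derivative_at_within[OF DERIV_sin])
    moreover have "(inverse (1 + (n / sqrt C * sin \<theta>)\<^sup>2) * (n / sqrt C * cos \<theta>)) / sqrt C = h \<theta>"
    proof -
      have "1 + (n / sqrt C * sin \<theta>)\<^sup>2 = (C + n\<^sup>2 * (sin \<theta>)\<^sup>2) / C"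
        using C by (simp add: power_mult_distrib power_divide field_simps)
      then have "(inverse (1 + (n / sqrt C * sin \<theta>)\<^sup>2) * (n / sqrt C * cos \<theta>)) / sqrt C
          = C / (C + n\<^sup>2 * (sin \<theta>)\<^sup>2) * (n * cos \<theta> / (sqrt C * sqrt C))"
        by (simp only:) (simp add: mult_ac)
      also have "\<dots> = h \<theta>"
        using C by (simp add: h_def)
      finally show ?thesis .
    qed
    ultimately show "((\<lambda>\<theta>. arctan (n / sqrt C * sin \<theta>) / sqrt C) has_vector_derivative h \<theta>) (at \<theta> within {0..pi / 2})"
      by (simp add: has_real_derivative_iff_has_vector_derivative)
  qed simp
  then have "(h has_integral arctan (n / sqrt C) / sqrt C) {0..pi / 2}"
    by simp
  moreover have "((\<lambda>_. 1) has_integral (pi / 2)) {0..pi / 2}"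
    using has_integral_const_real[of "1 :: real" 0 "pi / 2"] by simp
  ultimately have int_h: "((\<lambda>\<theta>. 4 * C * sqrt (B + 1) * (h \<theta> + 1)) has_integral
      4 * C * sqrt (B + 1) * (arctan (n / sqrt C) / sqrt C + pi / 2)) {0..pi / 2}"
    by (intro has_integral_mult_right has_integral_add)
  have "T * (F \<theta> - G \<theta>) \<le> 4 * C * sqrt (B + 1) * (h \<theta> + 1)" if \<theta>: "\<theta> \<in> {0..pi / 2}" for \<theta>
  proof -
    define d where "d = C + n\<^sup>2 * (sin \<theta>)\<^sup>2"
    define q where "q = sqrt (T + u \<theta>)"
    have d: "0 < d" "u \<theta> + B = d" using den uB by (simp_all add: d_def)
    have Tu: "T / 2 \<le> T + u \<theta>" "0 < T"
      using u(1)[of \<theta>] AB T by auto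
    then have q: "0 < q" "q * q = T + u \<theta>" by (auto simp: q_def)
    have "T\<^sup>2 \<le> (2 * n * q)\<^sup>2"
    proof -
      \<comment> \<open>Both factors use \<open>\<bar>A\<bar> < B \<le> T / 2\<close>.\<close>
      have "T * T \<le> (2 * (T - A)) * (2 * (T + u \<theta>))"
        using AB T Tu by (intro mult_mono) auto
      moreover have "(2 * n * q)\<^sup>2 = (2 * (n * n)) * (2 * (q * q))"
        by (simp add: power2_eq_square)
      ultimately show ?thesis
        unfolding n(2) q(2) by (simp only: power2_eq_square)
    qed
    then have Tq: "T \<le> 2 * n * q"
      by (rule power2_le_imp_le) (use n(1) q(1) in simp)
    \<comment> \<open>Since \<open>d = u + B\<close>, this follows from
      \<open>u \<le> u^2 + 4\<close> and \<open>B \<le> B (u^2 + 4)\<close>.\<close>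
    have "d * d \<le> (B + 1) * (d * ((u \<theta>)\<^sup>2 + 4))"
    proof -
      have "u \<theta> \<le> (u \<theta>)\<^sup>2 + 4"
        using zero_le_power2[of "u \<theta> - 1 / 2"] by (simp add: power2_eq_square algebra_simps)
      moreover have "B * 1 \<le> B * ((u \<theta>)\<^sup>2 + 4)"
        using AB by (intro mult_left_mono) auto
      ultimately have "d \<le> (B + 1) * ((u \<theta>)\<^sup>2 + 4)"
        using d(2) by (simp add: algebra_simps)
      then have "d * d \<le> d * ((B + 1) * ((u \<theta>)\<^sup>2 + 4))"
        using d(1) by (intro mult_left_mono) auto
      then show ?thesis by (simp add: mult_ac)
    qed
    then have "sqrt (d * d) \<le> sqrt ((B + 1) * (d * ((u \<theta>)\<^sup>2 + 4)))"
      by (rule real_sqrt_le_mono)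
    then have dr: "d \<le> sqrt (B + 1) * sqrt (d * ((u \<theta>)\<^sup>2 + 4))"
      using d(1) by (simp only: real_sqrt_mult) simp
    define r where "r = sqrt (d * ((u \<theta>)\<^sup>2 + 4))"
    have r: "0 < r" using d(1) sq_plus_4_pos by (simp add: r_def)
    have "sqrt ((u \<theta> + B) * (T + u \<theta>) * ((u \<theta>)\<^sup>2 + 4)) = q * r"
      unfolding d(2) q_def r_def by (simp add: real_sqrt_mult)
    then have "F \<theta> - G \<theta> = 2 * C / (q * r)"
      by (simp add: F_def G_def C_def diff_divide_distrib[symmetric])
    then have "T * (F \<theta> - G \<theta>) = 2 * C * (T / q) * (1 / r)"
      by simp
    also have "\<dots> \<le> 2 * C * (2 * n) * (sqrt (B + 1) / d)"
    proof (intro mult_mono)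
      show "T / q \<le> 2 * n" using Tq q(1) by (simp add: divide_simps)
      show "1 / r \<le> sqrt (B + 1) / d"
        using dr d(1) r unfolding r_def[symmetric] by (simp add: divide_simps)
    qed (use C n(1) r q(1) Tu(2) in auto)
    also have "\<dots> = 4 * C * sqrt (B + 1) * (n / d)"
      by simp
    also have "\<dots> \<le> 4 * C * sqrt (B + 1) * (h \<theta> + 1)"
    proof (rule mult_left_mono)
      \<comment> \<open>\<open>1 - cos \<theta> \<le> sin\<^sup>2 \<theta>\<close> reduces the bound to the explicitly integrable \<open>h\<close>.\<close>
      note sc = sin_cos_nonneg[OF \<theta>]
      have "cos \<theta> * cos \<theta> \<le> cos \<theta>"
        using sc by (intro mult_left_le) auto
      then have "1 - cos \<theta> \<le> (sin \<theta>)\<^sup>2"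
        by (simp add: sin_squared_eq flip: power2_eq_square)
      then have "n * (1 - cos \<theta>) \<le> n * (sin \<theta>)\<^sup>2"
        using n(1) by (intro mult_left_mono) auto
      also have "\<dots> \<le> n\<^sup>2 * (sin \<theta>)\<^sup>2"
        using n(1) by (intro mult_right_mono) (auto simp: power2_eq_square)
      also have "\<dots> \<le> d" using C by (simp add: d_def)
      finally have "n \<le> n * cos \<theta> + d" by (simp add: algebra_simps)
      then show "n / d \<le> h \<theta> + 1"
        using d(1) unfolding h_def d_def[symmetric] by (simp add: divide_simps)
    qed (use C AB in auto)
    finally show ?thesis .
  qed
  from has_integral_le[OF int_FG int_h this]
  have "T * (integral {0..pi / 2} F - integral {0..pi / 2} G)
      \<le> 4 * C * sqrt (B + 1) * (arctan (n / sqrt C) / sqrt C + pi / 2)" .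
  also have "\<dots> \<le> 4 * C * sqrt (B + 1) * (pi / (2 * sqrt C) + pi / 2)"
  proof (intro mult_left_mono add_right_mono)
    have "arctan (n / sqrt C) / sqrt C \<le> (pi / 2) / sqrt C"
      using C arctan_ubound[of "n / sqrt C"] by (intro divide_right_mono) auto
    then show "arctan (n / sqrt C) / sqrt C \<le> pi / (2 * sqrt C)" by simp
  qed (use C AB in auto)
  finally show ?thesis
    by (simp add: C_def F_def[abs_def] G_def[abs_def] u_def inner_edge_def outer_edge_def)
qed

text \<open>Rescaling by \<open>T\<close> with \<open>e = 1 / T\<^sup>2\<close> makes \<open>T = \<infinity>\<close> the regular parameter value \<open>e = 0\<close>.\<close>

definition scaled_middle_edge :: "real \<Rightarrow> real \<Rightarrow> real \<Rightarrow> real" where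
  "scaled_middle_edge A B e = integral {0..pi / 2} (\<lambda>\<theta>. 2 * (A + B) * (sin \<theta>)\<^sup>2
     / sqrt ((1 - e * (sin_arc (- A) B \<theta>)\<^sup>2) * ((sin_arc (- A) B \<theta>)\<^sup>2 + 4)))"

lemma scaled_middle_edge_eq:
  assumes "0 < T"
  shows "T * middle_edge A B T = scaled_middle_edge A B (1 / T\<^sup>2)"
proof -
  have "T * (k / sqrt ((T\<^sup>2 - v) * w)) = k / sqrt ((1 - 1 / T\<^sup>2 * v) * w)" for k v w
  proof -
    have "(T\<^sup>2 - v) * w = T\<^sup>2 * ((1 - 1 / T\<^sup>2 * v) * w)"
      using assms by (simp add: field_simps)
    then have "sqrt ((T\<^sup>2 - v) * w) = T * sqrt ((1 - 1 / T\<^sup>2 * v) * w)"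
      using assms by (simp only: real_sqrt_mult) simp
    then show ?thesis using assms by simp
  qed
  then show ?thesis
    unfolding middle_edge_def scaled_middle_edge_def integral_mult_right[symmetric] by simp
qed

text \<open>The bound on \<open>e\<close>, that is \<open>T \<ge> 2 R\<close>, gives
  \<open>e u^2 \<le> 1/4\<close> on the edge and keeps the radicand positive.\<close>

lemma continuous_on_scaled_middle_edge:
  assumes AB: "0 < A + B" "\<bar>A\<bar> \<le> R" "\<bar>B\<bar> \<le> R" "0 < R"
  shows "continuous_on {0..1 / (4 * R\<^sup>2)} (scaled_middle_edge A B)"
proof -
  have "0 < (1 - e * (sin_arc (- A) B \<theta>)\<^sup>2) * ((sin_arc (- A) B \<theta>)\<^sup>2 + 4)"
    if e: "e \<in> {0..1 / (4 * R\<^sup>2)}" for e \<theta>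
  proof -
    have "(sin_arc (- A) B \<theta>)\<^sup>2 \<le> R\<^sup>2"
      using sin_arc_bounds[of "- A" B \<theta>] AB by (intro power2_le_iff_abs_le[THEN iffD2]) auto
    then have "e * (sin_arc (- A) B \<theta>)\<^sup>2 \<le> 1 / (4 * R\<^sup>2) * R\<^sup>2"
      using e by (intro mult_mono) auto
    also have "\<dots> < 1" using AB by simp
    finally show ?thesis
      by (intro mult_pos_pos sq_plus_4_pos) simp
  qed
  then have "continuous_on ({0..1 / (4 * R\<^sup>2)} \<times> cbox 0 (pi / 2)) (\<lambda>(e, \<theta>). 2 * (A + B) * (sin \<theta>)\<^sup>2
     / sqrt ((1 - e * (sin_arc (- A) B \<theta>)\<^sup>2) * ((sin_arc (- A) B \<theta>)\<^sup>2 + 4)))"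
    unfolding case_prod_beta
    by (intro continuous_on_divide_sqrt) (auto intro!: continuous_intros)
  from integral_continuous_on_param[OF this] show ?thesis
    unfolding scaled_middle_edge_def[abs_def] by simp
qed

lemma integral_reflect_quarter:
  fixes f :: "real \<Rightarrow> real"
  shows "integral {0..pi / 2} (\<lambda>\<theta>. f (pi / 2 - \<theta>)) = integral {0..pi / 2} f"
  using integral_shift_real_ivl[of 0 "pi / 2" "pi / 2" f]
    Henstock_Kurzweil_Integration.integral_reflect_real[of 0 "- (pi / 2)" "\<lambda>x. f (x + pi / 2)"]
  by simp

text \<open>Both integrands are symmetrised under \<open>\<theta> \<mapsto> pi / 2 - \<theta>\<close>; the difference then becomes a multiple of
  \<open>cos (2 * \<theta>)\<close> times a difference of values of \<open>\<lambda>v. 1 / sqrt (v\<^sup>2 + 4)\<close> that has the same sign.\<close>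

lemma scaled_middle_edge_0_less:
  assumes AB: "0 < A + B" "A < B"
  shows "scaled_middle_edge A B 0 < scaled_middle_edge B A 0"
proof -
  \<comment> \<open>\<open>m\<close> and \<open>h\<close> are the midpoint and half-length of
    \<open>[-A, B]\<close>; the edge \<open>[-B, A]\<close> has midpoint \<open>-m\<close> and the
    same half-length.\<close>
  define m h where "m = (B - A) / 2" and "h = (A + B) / 2"
  have mh: "0 < m" "0 < h" using AB by (simp_all add: m_def h_def)
  define w where "w v = 1 / sqrt (v\<^sup>2 + 4)" for v :: real
  define f g where "f \<theta> = 2 * (A + B) * (sin \<theta>)\<^sup>2 * w (m - h * cos (2 * \<theta>))"
    and "g \<theta> = 2 * (A + B) * (sin \<theta>)\<^sup>2 * w (m + h * cos (2 * \<theta>))" for \<theta>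
  have arcs: "sin_arc (- A) B \<theta> = m - h * cos (2 * \<theta>)" "sin_arc (- B) A \<theta> = - (m + h * cos (2 * \<theta>))" for \<theta>
    unfolding sin_arc_def m_def h_def cos_double_sin by (simp_all add: field_simps)
  have SA: "scaled_middle_edge A B 0 = integral {0..pi / 2} f"
    unfolding scaled_middle_edge_def f_def[abs_def] w_def arcs by simp
  have SB: "scaled_middle_edge B A 0 = integral {0..pi / 2} g"
    unfolding scaled_middle_edge_def g_def[abs_def] w_def arcs power2_minus by (simp add: add.commute)
  have w_cont: "continuous_on UNIV w"
    unfolding w_def[abs_def] by (rule continuous_on_divide_sqrt) (auto intro!: continuous_intros sq_plus_4_pos)
  have fg_cont: "continuous_on S f" "continuous_on S g" for S
    unfolding f_def[abs_def] g_def[abs_def]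
    by (intro continuous_intros continuous_on_compose2[OF w_cont]; simp)+
  have refl_cont: "continuous_on S (\<lambda>\<theta>. f (pi / 2 - \<theta>))" "continuous_on S (\<lambda>\<theta>. g (pi / 2 - \<theta>))" for S
    by (rule continuous_on_compose2[OF fg_cont(1)[of UNIV]], auto intro!: continuous_intros)
      (rule continuous_on_compose2[OF fg_cont(2)[of UNIV]], auto intro!: continuous_intros)
  \<comment> \<open>Reflection preserves each integral, so the integral of \<open>d\<close> is twice
    the difference sought.\<close>
  define d where "d \<theta> = (g \<theta> + g (pi / 2 - \<theta>)) - (f \<theta> + f (pi / 2 - \<theta>))" for \<theta>
  have d_cont: "continuous_on {0..pi / 2} d"
    unfolding d_def[abs_def] by (intro continuous_intros fg_cont refl_cont)
  have "(d has_integral (integral {0..pi / 2} g + integral {0..pi / 2} (\<lambda>\<theta>. g (pi / 2 - \<theta>)))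
      - (integral {0..pi / 2} f + integral {0..pi / 2} (\<lambda>\<theta>. f (pi / 2 - \<theta>)))) {0..pi / 2}"
    unfolding d_def[abs_def]
    by (intro has_integral_diff has_integral_add integrable_integral integrable_continuous_real fg_cont refl_cont)
  then have int_d: "integral {0..pi / 2} d = 2 * (scaled_middle_edge B A 0 - scaled_middle_edge A B 0)"
    unfolding integral_reflect_quarter SA SB by (simp add: integral_unique)
  have d_eq: "d \<theta> = 2 * (A + B) * (cos (2 * \<theta>) * (w (m - h * cos (2 * \<theta>)) - w (m + h * cos (2 * \<theta>))))" for \<theta>
  proof -
    have "cos (2 * (pi / 2 - \<theta>)) = - cos (2 * \<theta>)"
      by (simp add: right_diff_distrib)
    moreover have "sin (pi / 2 - \<theta>) = cos \<theta>"
      by (simp add: sin_diff)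
    ultimately have "d \<theta> = 2 * (A + B) * (((cos \<theta>)\<^sup>2 - (sin \<theta>)\<^sup>2)
        * (w (m - h * cos (2 * \<theta>)) - w (m + h * cos (2 * \<theta>))))"
      unfolding d_def f_def g_def by (simp only:) (simp add: algebra_simps)
    then show ?thesis
      by (simp only: cos_double)
  qed
  have w_less: "w v < w v'" if "v'\<^sup>2 < v\<^sup>2" for v v'
    unfolding w_def using that sq_plus_4_pos by (intro divide_strict_left_mono mult_pos_pos) auto
  have squares: "(m + h * x)\<^sup>2 - (m - h * x)\<^sup>2 = 4 * (m * h) * x" for x
    by (simp add: power2_eq_square algebra_simps)
  \<comment> \<open>By \<open>squares\<close> the sign of \<open>x\<close> decides which argument is
    smaller in modulus, and \<open>w\<close> decreases with the modulus.\<close>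
  have sign: "0 < x * (w (m - h * x) - w (m + h * x))" if "x \<noteq> 0" for x
  proof (cases "0 < x")
    case True
    then have "0 < 4 * (m * h) * x" using mh by simp
    then have "(m - h * x)\<^sup>2 < (m + h * x)\<^sup>2" using squares[of x] by linarith
    then show ?thesis using True w_less by simp
  next
    case False
    then have "x < 0" using that by simp
    then have "4 * (m * h) * x < 0" using mh by (simp add: mult_pos_neg)
    then have "(m + h * x)\<^sup>2 < (m - h * x)\<^sup>2" using squares[of x] by linarith
    then show ?thesis using \<open>x < 0\<close> w_less by (intro mult_neg_neg) auto
  qed
  have d_nonneg: "0 \<le> d \<theta>" for \<theta>
    unfolding d_eq using AB sign[of "cos (2 * \<theta>)"] by (cases "cos (2 * \<theta>) = 0") auto
  \<comment> \<open>Strictness: a continuous nonnegative function with integral \<open>0\<close>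
    would vanish at \<open>\<theta> = 0\<close>.\<close>
  have "0 < d 0"
    unfolding d_eq using AB sign[of 1] by simp
  then have "integral {0..pi / 2} d \<noteq> 0"
    using integral_eq_0_iff[OF d_cont] d_nonneg by force
  moreover have "0 \<le> integral {0..pi / 2} d"
    by (rule integral_nonneg[OF integrable_continuous_real[OF d_cont] d_nonneg])
  ultimately have "0 < integral {0..pi / 2} d"
    by simp
  then show ?thesis
    using int_d by simp
qed

lemma period_defect_pos:
  assumes AB: "0 < A + B" "A < B"
  shows "\<forall>\<^sub>F T in at_top. 0 < period_defect A B T"
proof -
  have A: "\<bar>A\<bar> < B" "0 < B" "0 < B + A" using AB by auto
  define I J where "I = scaled_middle_edge A B" and "J = scaled_middle_edge B A"
  define S where "S = {0..1 / (4 * B\<^sup>2)}"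
  have cont: "continuous_on S I" "continuous_on S J"
    unfolding I_def J_def S_def using A AB by (auto intro!: continuous_on_scaled_middle_edge)
  \<comment> \<open>Half the limiting gap, so that \<open>J - I\<close> eventually exceeds
    \<open>\<delta>\<close>.\<close>
  define \<delta> where "\<delta> = (J 0 - I 0) / 2"
  have \<delta>: "0 < \<delta>" "\<delta> < J 0 - I 0"
    using scaled_middle_edge_0_less[OF AB] by (simp_all add: \<delta>_def I_def J_def)
  define M where "M = 4 * (A + B) * sqrt (B + 1) * (pi / (2 * sqrt (A + B)) + pi / 2)"
  have M: "0 \<le> M" 
  proof -
    have "0 \<le> pi / (2 * sqrt (A + B)) + pi / 2"
      using AB by (intro add_nonneg_nonneg divide_nonneg_nonneg) auto
    then show ?thesis
      unfolding M_def using AB A by (intro mult_nonneg_nonneg) auto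
  qed
  have e_lim: "filterlim (\<lambda>T::real. 1 / T\<^sup>2) (at 0 within S) at_top"
    unfolding filterlim_at
  proof (intro conjI)
    show "((\<lambda>T::real. 1 / T\<^sup>2) \<longlongrightarrow> 0) at_top"
      by (auto intro!: tendsto_divide_0[OF tendsto_const] filterlim_at_top_imp_at_infinity
          filterlim_pow_at_top filterlim_ident)
    show "\<forall>\<^sub>F T in at_top. 1 / T\<^sup>2 \<in> S \<and> 1 / T\<^sup>2 \<noteq> 0"
      using eventually_ge_at_top[of "2 * B"]
    proof eventually_elim
      case (elim T)
      then have "(2 * B)\<^sup>2 \<le> T\<^sup>2" using A by (intro power_mono) auto
      moreover have "0 < T" using elim A by simp
      ultimately show ?case using A by (auto simp: S_def frac_le)
    qed
  qed
  have "0 \<in> S" using A by (simp add: S_def)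
  then have lim: "((\<lambda>T. I (1 / T\<^sup>2)) \<longlongrightarrow> I 0) at_top" "((\<lambda>T. J (1 / T\<^sup>2)) \<longlongrightarrow> J 0) at_top"
    using cont e_lim by (auto simp: continuous_on_def intro: filterlim_compose)
  have evI: "\<forall>\<^sub>F T in at_top. I (1 / T\<^sup>2) < I 0 + 1"
    using order_tendstoD(2)[OF lim(1)] by simp
  have evJI: "\<forall>\<^sub>F T in at_top. \<delta> < J (1 / T\<^sup>2) - I (1 / T\<^sup>2)"
    using order_tendstoD(1)[OF tendsto_diff[OF lim(2) lim(1)]] \<delta> by simp
  \<comment> \<open>Once \<open>ln (T + 2)\<close> exceeds \<open>K\<close>, the logarithmic bound
    gives \<open>P > M * (I 0 + 1) / \<delta>\<close>.\<close>
  define K where "K = ln (B + 2) + M * (I 0 + 1) / \<delta>"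
  have evln: "\<forall>\<^sub>F T in at_top. K < ln (T + 2)"
    using eventually_gt_at_top[of "exp K"]
  proof eventually_elim
    case (elim T)
    moreover have "0 < T" using elim exp_gt_zero[of K] by linarith
    ultimately have "ln (exp K) < ln (T + 2)"
      by (subst ln_less_cancel_iff) auto
    then show ?case by simp
  qed
  show ?thesis
    using evI evJI evln eventually_ge_at_top[of "2 * B"] eventually_ge_at_top[of "B + 1"]
  proof eventually_elim
    case (elim T)
    have T: "B < T" "0 < T" "\<bar>A\<bar> < T" using elim A by auto
    have I2: "T * middle_edge A B T = I (1 / T\<^sup>2)" and J2: "T * middle_edge B A T = J (1 / T\<^sup>2)"
      using scaled_middle_edge_eq[OF T(2)] by (simp_all add: I_def J_def)
    define P where "P = T * (outer_edge A B T + inner_edge A B T)"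
    define W where "W = T * (inner_edge B A T + outer_edge B A T)"
    have I_pos: "0 < I (1 / T\<^sup>2)"
      unfolding I2[symmetric] using middle_edge_pos[OF AB(1), of T] T A by simp
    have "ln (T + 2) - ln (B + 2) \<le> T * inner_edge A B T"
      by (rule inner_edge_ge_log) (use AB A T in auto)
    moreover have "0 \<le> T * outer_edge A B T"
      using outer_edge_nonneg[OF AB(1), of T] T by (intro mult_nonneg_nonneg) auto
    ultimately have "ln (T + 2) - ln (B + 2) \<le> P"
      by (simp add: P_def distrib_left)
    then have P: "M * (I 0 + 1) / \<delta> < P" using elim(3) by (simp add: K_def)
    have "T * (outer_edge B A T - inner_edge A B T) \<le> 0"
      using outer_edge_swapped_le_inner_edge[OF AB(1), of T] T A by (intro mult_nonneg_nonpos) auto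
    moreover have "T * (inner_edge B A T - outer_edge A B T) \<le> M"
      unfolding M_def by (rule inner_minus_outer_edge_bounded) (use AB A elim in auto)
    ultimately have W: "W \<le> P + M"
      by (simp add: W_def P_def algebra_simps)
    have I0: "0 < I 0 + 1" using I_pos elim(1) by linarith
    have P0: "0 \<le> P" using P M I0 \<delta> by (meson divide_nonneg_pos less_eq_real_def mult_nonneg_nonneg order_trans)
    \<comment> \<open>With \<open>W \<le> P + M\<close> this is at least
      \<open>P (J - I) - M I\<close>, where the first term exceeds \<open>P \<delta>\<close> or
      equals it and the second is at most \<open>M * (I 0 + 1)\<close>.\<close>
    have "T\<^sup>2 * period_defect A B T = P * J (1 / T\<^sup>2) - W * I (1 / T\<^sup>2)"
      unfolding I2[symmetric] J2[symmetric] by (simp add: P_def W_def period_defect_def power2_eq_square algebra_simps)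
    also have "\<dots> \<ge> P * J (1 / T\<^sup>2) - (P + M) * I (1 / T\<^sup>2)"
      using W I_pos by (intro diff_left_mono mult_right_mono) auto
    finally have "P * (J (1 / T\<^sup>2) - I (1 / T\<^sup>2)) - M * I (1 / T\<^sup>2) \<le> T\<^sup>2 * period_defect A B T"
      by (simp add: algebra_simps)
    moreover have "P * \<delta> \<le> P * (J (1 / T\<^sup>2) - I (1 / T\<^sup>2))"
      using P0 elim(2) by (intro mult_left_mono) auto
    moreover have "M * I (1 / T\<^sup>2) \<le> M * (I 0 + 1)"
      using M elim(1) by (intro mult_left_mono) auto
    moreover have "M * (I 0 + 1) < P * \<delta>"
      using P \<delta> by (simp add: divide_simps)
    ultimately have "0 < T\<^sup>2 * period_defect A B T" by linarith
    then show ?case using T by (simp add: zero_less_mult_iff)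
  qed
qed

section \<open>The zero of the period condition\<close>

lemma period_defect_root:
  assumes AB: "0 < A + B" "A < B"
  shows "\<exists>T>B. period_defect A B T = 0"
proof -
  obtain T1 where T1: "B < T1" "period_defect A B T1 < 0"
    using period_defect_neg[OF AB] by blast
  obtain T2 where T2: "T1 \<le> T2" "0 < period_defect A B T2"
    using eventually_happens[OF eventually_conj[OF eventually_ge_at_top[of T1] period_defect_pos[OF AB]]]
    by auto
  have BA: "0 < B + A" using AB by simp
  have "continuous_on {T1..T2} (period_defect A B)"
    unfolding period_defect_def[abs_def]
    by (intro continuous_intros
        continuous_on_subset[OF continuous_on_edges(1)[OF AB(1)]]
        continuous_on_subset[OF continuous_on_edges(2)[OF AB(1)]]
        continuous_on_subset[OF continuous_on_edges(3)[OF AB(1)]]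
        continuous_on_subset[OF continuous_on_edges(1)[OF BA]]
        continuous_on_subset[OF continuous_on_edges(2)[OF BA]]
        continuous_on_subset[OF continuous_on_edges(3)[OF BA]]) (use AB T1 in auto)
  then obtain T where "T1 \<le> T" "T \<le> T2" "period_defect A B T = 0"
    using IVT'[of "period_defect A B" T1 0 T2] T1 T2 by auto
  then show ?thesis using T1 by (intro exI[of _ T] conjI) simp_all
qed

lemma Q_eq_period_defect:
  fixes a b t :: real
  assumes ab: "0 < a" "0 < b" "1 < a * b" "a < t" "b < t"
  defines "A \<equiv> a - 1/a" and "B \<equiv> b - 1/b" and "T \<equiv> t - 1/t"
  shows "Q a b t = period_defect A B T / (middle_edge A B T * middle_edge B A T)"
proof -
  have "0 < A + B" "0 < B + A" "\<bar>A\<bar> < T" "\<bar>B\<bar> < T"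
    using vertex_order[OF ab] by (simp_all add: A_def B_def T_def)
  then have "0 < middle_edge A B T" "0 < middle_edge B A T"
    by (simp_all add: middle_edge_pos)
  then show ?thesis
    unfolding Q_def edge_lengths[OF ab, folded A_def B_def T_def] period_defect_def
    by (simp add: field_simps)
qed

theorem mainTheorem6:
  fixes a b :: real
  assumes "a > 0" and "b > 0" and "a * b > 1"
  shows "(a = b \<longrightarrow> (\<forall>t. t > b \<longrightarrow> Q a b t = 0))
       \<and> (a < b \<longrightarrow> (\<exists>t. t > b \<and> Q a b t = 0))"
proof (intro conjI impI allI)
  fix t assume "a = b" "t > b"
  \<comment> \<open>For \<open>A = B\<close> the two products in the period defect are
    equal.\<close>
  then show "Q a b t = 0"
    using Q_eq_period_defect[of a b t] assms by (simp add: period_defect_def algebra_simps)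
next
  assume less: "a < b"
  define A B where "A = a - 1/a" and "B = b - 1/b"
  have AB: "0 < A + B" "A < B"
    \<comment> \<open>\<open>b + 1\<close> serves as a value of \<open>t\<close> above both
      \<open>a\<close> and \<open>b\<close>.\<close>
    using vertex_order(1)[of a b "b + 1"] diff_inverse_strict_mono[OF assms(1) less] assms less
    by (simp_all add: A_def B_def)
  obtain T where T: "B < T" "period_defect A B T = 0"
    using period_defect_root[OF AB] by blast
  \<comment> \<open>The positive root of \<open>t - 1/t = T\<close> is minus the negative root for
    \<open>-T\<close>; monotonicity of \<open>neg_branch\<close> then turns \<open>B < T\<close>
    into \<open>b < t\<close>.\<close>
  define t where "t = - neg_branch (- T)"
  have t: "0 < t" "t - 1/t = T"
    using neg_branch_neg[of "- T"] neg_branch_inverse[of "- T"] by (simp_all add: t_def)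
  have "neg_branch (- T) < neg_branch (- B)"
    using T(1) by (intro neg_branch_strict_mono) simp
  also have "neg_branch (- B) = - b"
    using neg_branch_unique[of "- b"] assms by (simp add: B_def)
  finally have "b < t" by (simp add: t_def)
  moreover have "Q a b t = 0"
    using Q_eq_period_defect[of a b t] assms less \<open>b < t\<close> T(2) by (simp add: t(2) A_def B_def)
  ultimately show "\<exists>t. t > b \<and> Q a b t = 0" by blast
qed

end
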